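(* Let $\mu\in\mathbb{C}$ have the following properties: 1. $\mu$ does not lie in the spectrum of $M$; 2. $m_n\to m$ and $\ell_n\to\ell$ as $n\to\infty$, uniformly on any compact annulus of sufficiently small outer radius surrounding $\mu$. Then there are only two possibilities: (a) there exist a neighbourhood $\mathcal{N}$ of $\mu$ and $N\in\mathbb{N}$ such that no eigenvalue of $M_n$ lies in $\mathcal{N}$ for any $n\ge N$; (b) there exist a monotone increasing sequence $(n_j)_{j\in\mathbb{N}}$ of positive integers and two associated sequences $(\lambda_j)_{j\in\mathbb{N}}$, $(\mu_j)_{j\in\mathbb{N}}$ such that $\lambda_j\in\sigma(M_{n_j})$ and $\mu_j\in\sigma(L_{n_j})$ for all $j$, and $\lambda_j\to\mu$, $\mu_j\to\mu$ as $j\to\infty$.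
   Context: Setting. $-\infty<a<b\le\infty$; $w>0$ and $p\ne0$ a.e. on $[a,b)$; $p,q$ are complex-valued; $w,1/p,q\in L^1_{loc}[a,b)$; and $Q=\overline{\mathrm{co}}\{q(x)/w(x)+rp(x):x\in[a,b),\,0<r<\infty\}\ne\mathbb{C}$ (closed convex hull). Put $\mathcal{M}[y]=\frac1w[-(py')'+qy]$. The endpoint $a$ is regular; $b$ is singular, i.e. $b=+\infty$ or $\int_a^b(w+1/|p|+|q|)\,dx=\infty$. "The differential equation" is $\mathcal{M}[y]=\lambda y$, and $L^2_w[a,b)$ is the space of $f$ with $\int_a^b|f|^2w\,dx<\infty$. Admissible pairs. $S$ is the set of pairs $(\eta,K)$ arising as follows: for some $\lambda_0\in\mathbb{C}\setminus Q$, $K$ is the point of $Q$ nearest to $\lambda_0$ and $\eta$ is a real angle such that $\Re[(rp(x)+q(x)/w(x)-K)e^{i\eta}]\ge0$ for all $x\in[a,b)$, $r\in(0,\infty)$, and $\Re[(\lambda_0-K)e^{i\eta}]<0$. $\Lambda_{\eta,K}=\{\lambda\in\mathbb{C}:\Re[(\lambda-K)e^{i\eta}]\le0\}$. A (possibly complex) number $\alpha$ is fixed; $S(\alpha)$ is the set of $(\eta,K)\in S$ with $\Re[e^{i\eta}\cos\alpha\,\overline{\sin\alpha}]\le0$, assumed nonempty, and $(\eta,K)\in S(\alpha)$ is fixed. Solutions. $\theta(\cdot,\lambda),\phi(\cdot,\lambda)$ are the solutions with $\phi(a,\lambda)=\sin\alpha$, $p\phi'(a,\lambda)=-\cos\alpha$,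 $\theta(a,\lambda)=\cos\alpha$, $p\theta'(a,\lambda)=\sin\alpha$. $[f,g]=p(fg'-f'g)$. Sims classification (known to be independent of $\lambda\in\Lambda_{\eta,K}$). Consider the condition ( * ): $\int_a^b\Re[e^{i\eta}\{p|y'|^2+(q-Kw)|y|^2\}]dx+\int_a^b|y|^2w\,dx<\infty$. For $\lambda\in\Lambda_{\eta,K}$ exactly one of the following holds. Case I: there is a unique (up to constant multiples) nontrivial solution satisfying ( * ), and it is the only one in $L^2_w[a,b)$. Case II: there is a unique (up to constant multiples) nontrivial solution satisfying ( * ), but all solutions lie in $L^2_w[a,b)$. Case III: all solutions lie in $L^2_w[a,b)$ and satisfy ( * ). Any of the three cases is allowed here. Operators $M$, $L$ and functions $m,\ell$. $M$ is the realization $My=\mathcal{M}[y]$ in $L^2_w[a,b)$, with domain the $y\in L^2_w[a,b)$ such that $y,py'$ are locally absolutely continuous on $[a,b)$, $\mathcal{M}[y]\in L^2_w[a,b)$, $(\cos\alpha)y(a)+(\sin\alpha)py'(a)=0$, and, in Cases II and III, additionally $[y,\psi(\cdot,\lambda')](b)=0$, where $\lambda'\in\Lambda_{\eta,K}$ is fixed and $\psi(\cdot,\lambda')=\theta(\cdot,\lambda')+m(\lambda')\phi(\cdot,\lambda')$ for the chosen value $m(\lambda')\in\mathbb{C}$ (the choice specifies the boundary condition at $b$). The Titchmarsh–Weyl function $m(\lambda)$ is the unique number such that $\theta(\cdot,\lambda)+m(\lambda)\phi(\cdot,\lambda)$ lies in $L^2_w[a,b)$ (Case I), respectively lies in $L^2_w[a,b)$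 and satisfies the boundary condition at $b$ (Cases II, III). It is known to be meromorphic and its poles are the eigenvalues of $M$ (in Cases II and III on all of $\mathbb{C}$; in Case I on $\mathbb{C}\setminus Q_b(\alpha)$, where $Q_b(\alpha)=\bigcap_{c\in(a,b)}Q_c(\alpha)$ and $Q_c(\alpha)$ is the set $\bigcap_{(\eta,K)\in S(\alpha)}(\mathbb{C}\setminus\Lambda_{\eta,K})$ formed with the interval $[c,b)$ in place of $[a,b)$). $L$ is defined like $M$ but with the condition at $a$ replaced by $(\sin\alpha)y(a)-(\cos\alpha)py'(a)=0$, the condition at $b$ (if any) being unchanged; $\ell$ is its Titchmarsh–Weyl function, and $m(\lambda)\ell(\lambda)=-1$. Truncations. $b_n\nearrow b$ is a sequence in $(a,b)$. $M_n$ is the regular operator $M_ny=\mathcal{M}[y]$ on $[a,b_n]$ with boundary conditions $(\cos\alpha)y(a)+(\sin\alpha)py'(a)=0$ and $y(b_n)\cos\beta_n+py'(b_n)\sin\beta_n=0$, where the $\beta_n$ are given (complex) numbers. $L_n$ is the same but with condition $(\sin\alpha)y(a)-(\cos\alpha)py'(a)=0$ at $a$. $m_n(\lambda)$ is the number such that $\theta+m_n(\lambda)\phi$ satisfies the boundary condition at $b_n$, i.e. $m_n(\lambda)=-\dfrac{\theta(b_n,\lambda)\cot\beta_n+p\theta'(b_n,\lambda)}{\phi(b_n,\lambda)\cot\beta_n+p\phi'(b_n,\lambda)}$, and $\ell_n$ is the corresponding function for $L_n$, so $m_n\ell_n=-1$. $\sigma(\cdot)$ denotes the spectrum. *)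

theory Defs
  imports "HOL-Analysis.Analysis"
begin

definition ico :: "real \<Rightarrow> ereal \<Rightarrow> real set" where
  "ico a b = {x. a \<le> x \<and> ereal x < b}"

text \<open>Local absolute continuity of \<open>F\<close> on an interval \<open>I\<close> with a.e. derivative \<open>f\<close>, in the
  form: \<open>f\<close> is locally Lebesgue integrable and \<open>F\<close> is an indefinite integral of \<open>f\<close>.  If \<open>I\<close> is
  compact this is absolute continuity on \<open>I\<close>.\<close>

definition AC_loc_deriv :: "real set \<Rightarrow> (real \<Rightarrow> complex) \<Rightarrow> (real \<Rightarrow> complex) \<Rightarrow> bool" where
  "AC_loc_deriv I F f \<longleftrightarrow>
     (\<forall>c\<in>I. \<forall>d\<in>I. c \<le> d \<longrightarrow>
        f absolutely_integrable_on {c..d} \<and> integral {c..d} f = F d - F c)"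

section \<open>The coefficients\<close>

definition sl_coefficients ::
  "real \<Rightarrow> ereal \<Rightarrow> (real \<Rightarrow> complex) \<Rightarrow> (real \<Rightarrow> complex) \<Rightarrow> (real \<Rightarrow> real) \<Rightarrow> bool" where
  "sl_coefficients a b p q w \<longleftrightarrow>
     ereal a < b \<and>
     (AE x in lebesgue_on (ico a b). 0 < w x \<and> p x \<noteq> 0) \<and>
     (\<forall>c\<in>ico a b. w absolutely_integrable_on {a..c} \<and>
        (\<lambda>x. 1 / p x) absolutely_integrable_on {a..c} \<and>
        q absolutely_integrable_on {a..c})"

definition singular_right_end ::
  "real \<Rightarrow> ereal \<Rightarrow> (real \<Rightarrow> complex) \<Rightarrow> (real \<Rightarrow> complex) \<Rightarrow> (real \<Rightarrow> real) \<Rightarrow> bool" where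
  "singular_right_end a b p q w \<longleftrightarrow>
     b = \<infinity> \<or>
     (\<integral>\<^sup>+ x. ennreal (w x + 1 / cmod (p x) + cmod (q x)) \<partial>(lebesgue_on (ico a b))) = \<infinity>"

text \<open>As \<open>w\<close> is only positive almost everywhere, the points (a null set) at which the quotient
  \<open>q/w\<close> is undefined are left out here and in \<open>sims_S\<close>.\<close>

definition sims_Q ::
  "real \<Rightarrow> ereal \<Rightarrow> (real \<Rightarrow> complex) \<Rightarrow> (real \<Rightarrow> complex) \<Rightarrow> (real \<Rightarrow> real) \<Rightarrow> complex set" where
  "sims_Q a b p q w = closure (convex hull
     {q x / of_real (w x) + of_real r * p x | x r. x \<in> ico a b \<and> w x \<noteq> 0 \<and> 0 < r})"

definition sims_S ::
  "real \<Rightarrow> ereal \<Rightarrow> (real \<Rightarrow> complex) \<Rightarrow> (real \<Rightarrow> complex) \<Rightarrow> (real \<Rightarrow> real)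
     \<Rightarrow> (real \<times> complex) set" where
  "sims_S a b p q w = {(\<eta>, K). \<exists>lam0. lam0 \<notin> sims_Q a b p q w \<and>
     K = closest_point (sims_Q a b p q w) lam0 \<and>
     (\<forall>x\<in>ico a b. \<forall>r>0. w x \<noteq> 0 \<longrightarrow>
        0 \<le> Re ((of_real r * p x + q x / of_real (w x) - K) * cis \<eta>)) \<and>
     Re ((lam0 - K) * cis \<eta>) < 0}"

definition sims_S\<alpha> ::
  "real \<Rightarrow> ereal \<Rightarrow> (real \<Rightarrow> complex) \<Rightarrow> (real \<Rightarrow> complex) \<Rightarrow> (real \<Rightarrow> real) \<Rightarrow> complex
     \<Rightarrow> (real \<times> complex) set" where
  "sims_S\<alpha> a b p q w \<alpha> =
     {(\<eta>, K) \<in> sims_S a b p q w. Re (cis \<eta> * cos \<alpha> * cnj (sin \<alpha>)) \<le> 0}"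

definition half_plane :: "real \<Rightarrow> complex \<Rightarrow> complex set" where
  "half_plane \<eta> K = {lam. Re ((lam - K) * cis \<eta>) \<le> 0}"

section \<open>The differential equation\<close>

text \<open>\<open>sl_expr I p q w y u f\<close>: the functions \<open>y\<close> and \<open>u = py'\<close> are locally absolutely continuous on
  \<open>I\<close>, and \<open>f = (-(py')' + qy)/w\<close> a.e. on \<open>I\<close>.  The quasi-derivative \<open>py'\<close> is carried along
  as the continuous function \<open>u\<close>, because its values at single points are needed.\<close>

definition sl_expr ::
  "real set \<Rightarrow> (real \<Rightarrow> complex) \<Rightarrow> (real \<Rightarrow> complex) \<Rightarrow> (real \<Rightarrow> real) \<Rightarrow>
     (real \<Rightarrow> complex) \<Rightarrow> (real \<Rightarrow> complex) \<Rightarrow> (real \<Rightarrow> complex) \<Rightarrow> bool" where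
  "sl_expr I p q w y u f \<longleftrightarrow>
     (\<exists>y' u'. AC_loc_deriv I y y' \<and> AC_loc_deriv I u u' \<and>
        (AE x in lebesgue_on I. u x = p x * y' x) \<and>
        (AE x in lebesgue_on I. f x = 1 / of_real (w x) * (- u' x + q x * y x)))"

definition sl_solution ::
  "real set \<Rightarrow> (real \<Rightarrow> complex) \<Rightarrow> (real \<Rightarrow> complex) \<Rightarrow> (real \<Rightarrow> real) \<Rightarrow> complex \<Rightarrow>
     (real \<Rightarrow> complex) \<Rightarrow> (real \<Rightarrow> complex) \<Rightarrow> bool" where
  "sl_solution I p q w lam y u \<longleftrightarrow> sl_expr I p q w y u (\<lambda>x. lam * y x)"

section \<open>Weighted square-integrable functions, spectrum\<close>

definition L2w :: "real set \<Rightarrow> (real \<Rightarrow> real) \<Rightarrow> (real \<Rightarrow> complex) set" where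
  "L2w I w = {f. f \<in> borel_measurable (lebesgue_on I) \<and>
                 integrable (lebesgue_on I) (\<lambda>x. (cmod (f x))\<^sup>2 * w x)}"

definition L2w_norm :: "real set \<Rightarrow> (real \<Rightarrow> real) \<Rightarrow> (real \<Rightarrow> complex) \<Rightarrow> real" where
  "L2w_norm I w f = sqrt (integral\<^sup>L (lebesgue_on I) (\<lambda>x. (cmod (f x))\<^sup>2 * w x))"

text \<open>An operator in \<open>L\<^sup>2\<^sub>w(I)\<close> is given by its graph \<open>T\<close>, a relation between functions, where
  functions are identified if they agree a.e. on \<open>I\<close>.  The number \<open>\<lambda>\<close> is in the resolvent set
  if \<open>T - \<lambda>\<close> is a bijection of the domain onto \<open>L\<^sup>2\<^sub>w(I)\<close> with bounded inverse.\<close>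

type_synonym operator_graph = "(real \<Rightarrow> complex) \<Rightarrow> (real \<Rightarrow> complex) \<Rightarrow> bool"

definition op_resolvent_set :: "real set \<Rightarrow> (real \<Rightarrow> real) \<Rightarrow> operator_graph \<Rightarrow> complex set" where
  "op_resolvent_set I w T = {lam.
     (\<forall>f\<in>L2w I w. \<exists>y g. T y g \<and> (AE x in lebesgue_on I. g x - lam * y x = f x)) \<and>
     (\<forall>y g. T y g \<and> (AE x in lebesgue_on I. g x - lam * y x = 0)
        \<longrightarrow> (AE x in lebesgue_on I. y x = 0)) \<and>
     (\<exists>C. \<forall>y g. T y g \<longrightarrow> L2w_norm I w y \<le> C * L2w_norm I w (\<lambda>x. g x - lam * y x))}"

definition op_spectrum :: "real set \<Rightarrow> (real \<Rightarrow> real) \<Rightarrow> operator_graph \<Rightarrow> complex set" where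
  "op_spectrum I w T = - op_resolvent_set I w T"

definition op_eigenvalue :: "real set \<Rightarrow> operator_graph \<Rightarrow> complex \<Rightarrow> bool" where
  "op_eigenvalue I T lam \<longleftrightarrow>
     (\<exists>y. T y (\<lambda>x. lam * y x) \<and> \<not> (AE x in lebesgue_on I. y x = 0))"

section \<open>The Sims classification\<close>

text \<open>The integrability condition on solutions that distinguishes the cases, with \<open>u = py'\<close>, hence \<open>y' = u/p\<close> a.e.  For
  \<open>(\<eta>, K) \<in> S\<close> both integrands are nonnegative a.e., so that finiteness of the integrals is integrability.\<close>

definition sims_cond ::
  "real set \<Rightarrow> (real \<Rightarrow> complex) \<Rightarrow> (real \<Rightarrow> complex) \<Rightarrow> (real \<Rightarrow> real) \<Rightarrow> real \<Rightarrow> complex \<Rightarrow>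
     (real \<Rightarrow> complex) \<Rightarrow> (real \<Rightarrow> complex) \<Rightarrow> bool" where
  "sims_cond I p q w \<eta> K y u \<longleftrightarrow>
     integrable (lebesgue_on I) (\<lambda>x. Re (cis \<eta> *
        (p x * of_real ((cmod (u x / p x))\<^sup>2)
         + (q x - K * of_real (w x)) * of_real ((cmod (y x))\<^sup>2)))) \<and>
     integrable (lebesgue_on I) (\<lambda>x. (cmod (y x))\<^sup>2 * w x)"

datatype sims_case = Case_I | Case_II | Case_III

definition multiple_on :: "real set \<Rightarrow> (real \<Rightarrow> complex) \<Rightarrow> (real \<Rightarrow> complex) \<Rightarrow> bool" where
  "multiple_on I y y0 \<longleftrightarrow> (\<exists>k. \<forall>x\<in>I. y x = k * y0 x)"

fun sims_case_at ::
  "sims_case \<Rightarrow> real set \<Rightarrow> (real \<Rightarrow> complex) \<Rightarrow> (real \<Rightarrow> complex) \<Rightarrow> (real \<Rightarrow> real) \<Rightarrow>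
     real \<Rightarrow> complex \<Rightarrow> complex \<Rightarrow> bool" where
  "sims_case_at Case_I I p q w \<eta> K lam \<longleftrightarrow>
     (\<exists>y0 u0. sl_solution I p q w lam y0 u0 \<and> (\<exists>x\<in>I. y0 x \<noteq> 0) \<and> sims_cond I p q w \<eta> K y0 u0 \<and>
        (\<forall>y u. sl_solution I p q w lam y u \<and> sims_cond I p q w \<eta> K y u \<longrightarrow> multiple_on I y y0) \<and>
        (\<forall>y u. sl_solution I p q w lam y u \<and> y \<in> L2w I w \<longrightarrow> multiple_on I y y0))"
| "sims_case_at Case_II I p q w \<eta> K lam \<longleftrightarrow>
     (\<exists>y0 u0. sl_solution I p q w lam y0 u0 \<and> (\<exists>x\<in>I. y0 x \<noteq> 0) \<and> sims_cond I p q w \<eta> K y0 u0 \<and>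
        (\<forall>y u. sl_solution I p q w lam y u \<and> sims_cond I p q w \<eta> K y u \<longrightarrow> multiple_on I y y0)) \<and>
     (\<forall>y u. sl_solution I p q w lam y u \<longrightarrow> y \<in> L2w I w)"
| "sims_case_at Case_III I p q w \<eta> K lam \<longleftrightarrow>
     (\<forall>y u. sl_solution I p q w lam y u \<longrightarrow> y \<in> L2w I w \<and> sims_cond I p q w \<eta> K y u)"

text \<open>The case does not depend on \<open>\<lambda> \<in> \<Lambda>\<^sub>\<eta>\<^sub>,\<^sub>K\<close>, so it may be read off at any one point at which
  it is attained.  Quantifying over all of the closed half plane instead would be too strong: for
  \<open>-y'' = \<lambda>y\<close> on \<open>[0,\<infinity>)\<close> and \<open>\<eta> = 0\<close>, \<open>K = 0\<close> the boundary point \<open>\<lambda> = 0\<close>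
  falls under none of the cases.\<close>

definition in_sims_case ::
  "sims_case \<Rightarrow> real set \<Rightarrow> (real \<Rightarrow> complex) \<Rightarrow> (real \<Rightarrow> complex) \<Rightarrow> (real \<Rightarrow> real) \<Rightarrow>
     real \<Rightarrow> complex \<Rightarrow> bool" where
  "in_sims_case c I p q w \<eta> K \<longleftrightarrow> (\<exists>lam\<in>half_plane \<eta> K. sims_case_at c I p q w \<eta> K lam)"

section \<open>Boundary conditions and operators\<close>

text \<open>The boundary condition \<open>[y,\<psi>](b) = 0\<close>, in the sense of a limit, for \<open>[f,g] = p(fg' - f'g)\<close>.
  Pairs \<open>(y, u)\<close> and \<open>(\<psi>, \<psi>1)\<close> consist of a function and its quasi-derivative.
  In Case I there is no condition at \<open>b\<close>.\<close>

definition bc_right ::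
  "sims_case \<Rightarrow> ereal \<Rightarrow> (real \<Rightarrow> complex) \<Rightarrow> (real \<Rightarrow> complex) \<Rightarrow>
     (real \<Rightarrow> complex) \<Rightarrow> (real \<Rightarrow> complex) \<Rightarrow> bool" where
  "bc_right c b \<psi> \<psi>1 y u \<longleftrightarrow> c \<noteq> Case_I \<longrightarrow>
     ((\<lambda>x. y (real_of_ereal x) * \<psi>1 (real_of_ereal x) - u (real_of_ereal x) * \<psi> (real_of_ereal x))
        \<longlongrightarrow> 0) (at_left b)"

definition bc_trunc :: "real \<Rightarrow> complex \<Rightarrow> (real \<Rightarrow> complex) \<Rightarrow> (real \<Rightarrow> complex) \<Rightarrow> bool" where
  "bc_trunc d \<beta> y u \<longleftrightarrow> y d * cos \<beta> + u d * sin \<beta> = 0"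

definition bc_M :: "real \<Rightarrow> complex \<Rightarrow> (real \<Rightarrow> complex) \<Rightarrow> (real \<Rightarrow> complex) \<Rightarrow> bool" where
  "bc_M a \<alpha> y u \<longleftrightarrow> cos \<alpha> * y a + sin \<alpha> * u a = 0"

definition bc_L :: "real \<Rightarrow> complex \<Rightarrow> (real \<Rightarrow> complex) \<Rightarrow> (real \<Rightarrow> complex) \<Rightarrow> bool" where
  "bc_L a \<alpha> y u \<longleftrightarrow> sin \<alpha> * y a - cos \<alpha> * u a = 0"

definition sl_operator ::
  "real set \<Rightarrow> (real \<Rightarrow> complex) \<Rightarrow> (real \<Rightarrow> complex) \<Rightarrow> (real \<Rightarrow> real) \<Rightarrow>
     ((real \<Rightarrow> complex) \<Rightarrow> (real \<Rightarrow> complex) \<Rightarrow> bool) \<Rightarrow>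
     ((real \<Rightarrow> complex) \<Rightarrow> (real \<Rightarrow> complex) \<Rightarrow> bool) \<Rightarrow> operator_graph" where
  "sl_operator I p q w bca bcb = (\<lambda>y f. y \<in> L2w I w \<and> f \<in> L2w I w \<and>
     (\<exists>u. sl_expr I p q w y u f \<and> bca y u \<and> bcb y u))"

section \<open>Titchmarsh--Weyl functions\<close>

text \<open>Here \<open>\<theta>, \<theta>1, \<phi>, \<phi>1\<close> are the values at the spectral parameter under
  consideration of \<open>\<theta>, p\<theta>', \<phi>, p\<phi>'\<close>.  The relations below say that \<open>z\<close> is a value of
  the respective function.

  The condition at \<open>a\<close> for \<open>L\<close> is that for \<open>M\<close> with \<open>\<alpha>\<close> replaced by \<open>\<alpha> - \<pi>/2\<close>, which turns
  \<open>(\<theta>, \<phi>)\<close> into \<open>(\<phi>, -\<theta>)\<close>.  So \<open>\<ell>\<close> and \<open>\<ell>\<^sub>n\<close> are obtained by using these relations for the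
  pair \<open>(\<phi>, -\<theta>)\<close>.\<close>

definition weyl_value ::
  "real set \<Rightarrow> (real \<Rightarrow> real) \<Rightarrow> ((real \<Rightarrow> complex) \<Rightarrow> (real \<Rightarrow> complex) \<Rightarrow> bool) \<Rightarrow>
     (real \<Rightarrow> complex) \<Rightarrow> (real \<Rightarrow> complex) \<Rightarrow> (real \<Rightarrow> complex) \<Rightarrow> (real \<Rightarrow> complex) \<Rightarrow>
     complex \<Rightarrow> bool" where
  "weyl_value I w bcb \<theta> \<theta>1 \<phi> \<phi>1 z \<longleftrightarrow>
     (\<lambda>x. \<theta> x + z * \<phi> x) \<in> L2w I w \<and> bcb (\<lambda>x. \<theta> x + z * \<phi> x) (\<lambda>x. \<theta>1 x + z * \<phi>1 x)"

definition trunc_weyl_value ::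
  "real \<Rightarrow> complex \<Rightarrow>
     (real \<Rightarrow> complex) \<Rightarrow> (real \<Rightarrow> complex) \<Rightarrow> (real \<Rightarrow> complex) \<Rightarrow> (real \<Rightarrow> complex) \<Rightarrow>
     complex \<Rightarrow> bool" where
  "trunc_weyl_value d \<beta> \<theta> \<theta>1 \<phi> \<phi>1 z \<longleftrightarrow>
     bc_trunc d \<beta> (\<lambda>x. \<theta> x + z * \<phi> x) (\<lambda>x. \<theta>1 x + z * \<phi>1 x)"

text \<open>Uniform convergence on all compact annuli of sufficiently small outer radius around \<open>\<mu>\<close>, for
  the partial functions given by their value relations \<open>P n\<close> and \<open>P\<^sub>0\<close> (\<open>P lam z\<close>: \<open>z\<close> is the
  value at \<open>lam\<close>; there is no unique value at a pole).  It includes that the limit and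
  eventually the approximants have a value at every point of the annulus.\<close>

definition converges_on_annuli ::
  "complex \<Rightarrow> (nat \<Rightarrow> complex \<Rightarrow> complex \<Rightarrow> bool) \<Rightarrow> (complex \<Rightarrow> complex \<Rightarrow> bool) \<Rightarrow> bool" where
  "converges_on_annuli \<mu> P P\<^sub>0 \<longleftrightarrow>
     (\<exists>R>0. \<forall>r s. 0 < r \<and> r < s \<and> s < R \<longrightarrow>
        (let A = cball \<mu> s - ball \<mu> r in
          (\<forall>lam\<in>A. \<exists>!z. P\<^sub>0 lam z) \<and>
          (\<forall>\<^sub>F n in sequentially. \<forall>lam\<in>A. \<exists>!z. P n lam z) \<and>
          uniform_limit A (\<lambda>n lam. THE z. P n lam z) (\<lambda>lam. THE z. P\<^sub>0 lam z) sequentially))"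

end

theory Submission
  imports Defs "HOL-Complex_Analysis.Complex_Analysis"
begin

text \<open>
  Put \<open>D\<^sub>n(\<lambda>) = \<phi>(b\<^sub>n,\<lambda>) cos \<beta>\<^sub>n + p\<phi>'(b\<^sub>n,\<lambda>) sin \<beta>\<^sub>n\<close> and let \<open>N\<^sub>n\<close> be the same expression
  for \<open>\<theta>\<close>.  Both are entire, the eigenvalues of \<open>M\<^sub>n\<close> and \<open>L\<^sub>n\<close> are the zeros of \<open>D\<^sub>n\<close> and \<open>N\<^sub>n\<close>,
  and \<open>m\<^sub>n = - N\<^sub>n / D\<^sub>n\<close>, \<open>\<ell>\<^sub>n = D\<^sub>n / N\<^sub>n\<close>.  As \<open>\<mu>\<close> is in the resolvent set of \<open>M\<close>, the function \<open>m\<close> is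
  bounded near \<open>\<mu>\<close>.  If \<open>D\<^sub>n\<close> has zeros tending to \<open>\<mu>\<close> while \<open>N\<^sub>n\<close> has none nearby, then the \<open>\<ell>\<^sub>n\<close>
  are holomorphic near \<open>\<mu>\<close>, uniformly bounded by the maximum principle, and vanish close to \<open>\<mu>\<close>;
  so they are small on a small circle around \<open>\<mu>\<close>, where \<open>\<bar>\<ell>\<^sub>n\<bar> = 1 / \<bar>m\<^sub>n\<bar>\<close> is bounded below:
  a contradiction.
\<close>

section \<open>Absolutely continuous functions\<close>

text \<open>With the exceptional null set made explicit, passing to a subinterval is mere inclusion
  of sets, and facts about \<open>negligible\<close> sets (changing an integrand, differentiating an
  integral) apply directly.\<close>

lemma AE_lebesgue_on_iff_negligible:
  assumes "S \<in> sets lebesgue"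
  shows "(AE x in lebesgue_on S. P x) \<longleftrightarrow> (\<exists>N. negligible N \<and> (\<forall>x\<in>S - N. P x))"
proof -
  have "(AE x in lebesgue_on S. P x) \<longleftrightarrow> (AE x in lebesgue. x \<in> S \<longrightarrow> P x)"
    using assms by (subst AE_restrict_space_iff) auto
  also have "\<dots> \<longleftrightarrow> (\<exists>N. negligible N \<and> (\<forall>x\<in>S - N. P x))"
    unfolding completion.AE_iff_null_sets negligible_iff_null_sets[symmetric]
    by (auto 4 3 intro: negligible_subset)
  finally show ?thesis .
qed

lemma AE_lebesgue_on_subset:
  assumes "AE x in lebesgue_on S. P x" "T \<subseteq> S" "S \<in> sets lebesgue" "T \<in> sets lebesgue"
  shows "AE x in lebesgue_on T. P x"
  using assms unfolding AE_lebesgue_on_iff_negligible[OF assms(3)] AE_lebesgue_on_iff_negligible[OF assms(4)]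
  by blast

lemma integral_cong_AE_lebesgue_on:
  fixes f g :: "real \<Rightarrow> 'b::euclidean_space"
  assumes "AE x in lebesgue_on S. f x = g x" "S \<in> sets lebesgue"
  shows "integral S f = integral S g"
proof -
  obtain N where "negligible N" "\<forall>x\<in>S - N. f x = g x"
    using assms(1) unfolding AE_lebesgue_on_iff_negligible[OF assms(2)] by blast
  then show ?thesis by (intro integral_spike[of N]) auto
qed

lemma continuous_mult_absolutely_integrable:
  fixes f g :: "real \<Rightarrow> complex"
  assumes "continuous_on {a..b} f" "g absolutely_integrable_on {a..b}"
  shows "(\<lambda>x. f x * g x) absolutely_integrable_on {a..b}"
proof (rule absolutely_integrable_bounded_measurable_product[where h = "(*)"])
  show "bilinear ((*) :: complex \<Rightarrow> complex \<Rightarrow> complex)"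
    by (rule bilinear_times)
  show "f \<in> borel_measurable (lebesgue_on {a..b})"
    by (rule continuous_imp_measurable_on_sets_lebesgue[OF assms(1)]) auto
  show "bounded (f ` {a..b})"
    by (intro compact_imp_bounded compact_continuous_image assms) auto
qed (use assms in auto)

lemma absolutely_integrable_on_subcbox:
  fixes f :: "real \<Rightarrow> 'b::euclidean_space"
  assumes "f absolutely_integrable_on {a..b}" "{c..d} \<subseteq> {a..b}"
  shows "f absolutely_integrable_on {c..d}"
  by (rule set_integrable_subset[OF assms(1) _ assms(2)]) auto

lemma AC_loc_deriv_subset:
  "AC_loc_deriv I F f \<Longrightarrow> J \<subseteq> I \<Longrightarrow> AC_loc_deriv J F f"
  unfolding AC_loc_deriv_def by blast

lemma AC_loc_derivD:
  assumes "AC_loc_deriv {a..b} F f" "a \<le> x" "x \<le> y" "y \<le> b"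
  shows "f absolutely_integrable_on {x..y}" "integral {x..y} f = F y - F x"
  using assms unfolding AC_loc_deriv_def by (metis atLeastAtMost_iff order_trans)+

lemma AC_loc_deriv_continuous:
  assumes "AC_loc_deriv {a..b} F f"
  shows "continuous_on {a..b} F"
proof (cases "a \<le> b")
  case True
  have "f integrable_on {a..b}"
    using AC_loc_derivD(1)[OF assms, of a b] True absolutely_integrable_on_def by blast
  then have "continuous_on {a..b} (\<lambda>x. F a + integral {a..x} f)"
    by (intro continuous_intros indefinite_integral_continuous_1)
  then show ?thesis
    by (rule continuous_on_eq) (use AC_loc_derivD(2)[OF assms order_refl] in auto)
qed auto

lemma AC_loc_deriv_lincomb:
  assumes "AC_loc_deriv I F f" "AC_loc_deriv I G g"
  shows "AC_loc_deriv I (\<lambda>x. s * F x + t * G x) (\<lambda>x. s * f x + t * g x)"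
  unfolding AC_loc_deriv_def
proof (intro ballI impI)
  fix c d assume cd: "c \<in> I" "d \<in> I" "c \<le> d"
  have fg: "f absolutely_integrable_on {c..d}" "g absolutely_integrable_on {c..d}"
    and eq: "integral {c..d} f = F d - F c" "integral {c..d} g = G d - G c"
    using assms cd unfolding AC_loc_deriv_def by auto
  have int: "f integrable_on {c..d}" "g integrable_on {c..d}"
    using fg absolutely_integrable_on_def by blast+
  have "(\<lambda>x. s * f x + t * g x) absolutely_integrable_on {c..d}"
    by (intro set_integral_add set_integrable_mult_right fg)
  moreover have "integral {c..d} (\<lambda>x. s * f x + t * g x) = s * F d + t * G d - (s * F c + t * G c)"
    using has_integral_add[OF has_integral_mult_right has_integral_mult_right,
        OF integrable_integral[OF int(1)] integrable_integral[OF int(2)], THEN integral_unique]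
    by (simp add: eq algebra_simps)
  ultimately show "(\<lambda>x. s * f x + t * g x) absolutely_integrable_on {c..d} \<and>
      integral {c..d} (\<lambda>x. s * f x + t * g x) = s * F d + t * G d - (s * F c + t * G c)"
    by blast
qed

text \<open>The increment of \<open>F * G - \<integral>(F g + G f)\<close> over a short interval is at most \<open>\<epsilon>\<close> times that of
  \<open>\<integral>(\<bar>f\<bar> + \<bar>g\<bar>)\<close>, by uniform continuity; summing up and letting \<open>\<epsilon> \<rightarrow> 0\<close> gives equality.\<close>

lemma AC_loc_deriv_mult:
  assumes F: "AC_loc_deriv {a..b} F f" and G: "AC_loc_deriv {a..b} G g"
  shows "AC_loc_deriv {a..b} (\<lambda>x. F x * G x) (\<lambda>x. F x * g x + G x * f x)"
  unfolding AC_loc_deriv_def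
proof (intro ballI impI)
  fix c d assume "c \<in> {a..b}" "d \<in> {a..b}" "c \<le> d"
  then have cd: "a \<le> c" "c \<le> d" "d \<le> b" by auto
  define h where "h = (\<lambda>x. F x * g x + G x * f x)"
  define v where "v = (\<lambda>x. norm (f x) + norm (g x))"
  have contF: "continuous_on {a..b} F" and contG: "continuous_on {a..b} G"
    using F G AC_loc_deriv_continuous by auto
  have fi: "f absolutely_integrable_on {x..y}" and gi: "g absolutely_integrable_on {x..y}"
    if "a \<le> x" "x \<le> y" "y \<le> b" for x y
    using AC_loc_derivD(1)[OF F that] AC_loc_derivD(1)[OF G that] by auto
  have hi: "h absolutely_integrable_on {x..y}" if "a \<le> x" "x \<le> y" "y \<le> b" for x y
    unfolding h_def using that
    by (intro set_integral_add continuous_mult_absolutely_integrable fi gi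
        continuous_on_subset[OF contF] continuous_on_subset[OF contG]) auto
  have vi: "v integrable_on {x..y}" if "a \<le> x" "x \<le> y" "y \<le> b" for x y
    unfolding v_def using fi[OF that] gi[OF that]
    by (intro integrable_add) (auto simp: absolutely_integrable_on_def)
  have int_add: "integral {x..z} h = integral {x..y} h + integral {y..z} h"
    "integral {x..z} v = integral {x..y} v + integral {y..z} v"
    if "a \<le> x" "x \<le> y" "y \<le> z" "z \<le> b" for x y z
    using that hi[of x z] vi[of x z]
    by (simp_all add: Henstock_Kurzweil_Integration.integral_combine absolutely_integrable_on_def)
  \<comment> \<open>Bolzano's bisection principle asks for the local estimate on all short intervals
    around a point of \<open>[c, d]\<close>, including those that leave \<open>[a, b]\<close>; the
    guards inside \<open>P\<close> make it vacuous there.\<close>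
  define P where "P = (\<lambda>\<epsilon> x y. a \<le> x \<longrightarrow> y \<le> b \<longrightarrow>
      norm (F y * G y - F x * G x - integral {x..y} h) \<le> \<epsilon> * integral {x..y} v)"
  have bound: "P \<epsilon> c d" if "\<epsilon> > 0" for \<epsilon>
    using \<open>c \<le> d\<close>
  proof (induct rule: Bolzano)
    case (trans x y z)
    show ?case
      unfolding P_def
    proof (intro impI)
      assume xz: "a \<le> x" "z \<le> b"
      let ?A = "F y * G y - F x * G x - integral {x..y} h"
      let ?B = "F z * G z - F y * G y - integral {y..z} h"
      have "norm ?A \<le> \<epsilon> * integral {x..y} v" "norm ?B \<le> \<epsilon> * integral {y..z} v"
        using trans xz by (auto simp: P_def)
      moreover have AB: "F z * G z - F x * G x - integral {x..z} h = ?A + ?B"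
        using int_add(1)[of x y z] trans xz by simp
      moreover have "\<epsilon> * integral {x..z} v = \<epsilon> * integral {x..y} v + \<epsilon> * integral {y..z} v"
        using int_add(2)[of x y z] trans xz by (simp add: distrib_left)
      ultimately show "norm (F z * G z - F x * G x - integral {x..z} h) \<le> \<epsilon> * integral {x..z} v"
        unfolding AB using norm_triangle_ineq[of ?A ?B] by linarith
    qed
  next
    case (local x0)
    have x0: "x0 \<in> {a..b}" using local cd by auto
    obtain d1 where d1: "d1 > 0" "\<And>x. x \<in> {a..b} \<Longrightarrow> dist x x0 < d1 \<Longrightarrow> dist (F x) (F x0) < \<epsilon>/2"
      using contF x0 \<open>\<epsilon> > 0\<close> unfolding continuous_on_iff by (meson half_gt_zero)
    obtain d2 where d2: "d2 > 0" "\<And>x. x \<in> {a..b} \<Longrightarrow> dist x x0 < d2 \<Longrightarrow> dist (G x) (G x0) < \<epsilon>/2"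
      using contG x0 \<open>\<epsilon> > 0\<close> unfolding continuous_on_iff by (meson half_gt_zero)
    show ?case
    proof (intro exI[of _ "min d1 d2"] conjI allI impI)
      fix x y assume xy: "x \<le> x0 \<and> x0 \<le> y \<and> y - x < min d1 d2"
      show "P \<epsilon> x y"
        unfolding P_def
      proof (intro impI)
        assume ab: "a \<le> x" "y \<le> b"
        then have le: "x \<le> y" using xy by auto
        have Fy: "norm (F y - F t) \<le> \<epsilon>" and Gx: "norm (G x - G t) \<le> \<epsilon>" if "t \<in> {x..y}" for t
        proof -
          have "dist (F y) (F x0) < \<epsilon>/2" "dist (F t) (F x0) < \<epsilon>/2"
            "dist (G x) (G x0) < \<epsilon>/2" "dist (G t) (G x0) < \<epsilon>/2"
            using that xy ab d1 d2 by (auto simp: dist_real_def)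
          then show "norm (F y - F t) \<le> \<epsilon>" "norm (G x - G t) \<le> \<epsilon>"
            by (metis dist_norm dist_triangle_half_l less_imp_le dist_commute)+
        qed
        have fI: "f integrable_on {x..y}" and gI: "g integrable_on {x..y}" and hI: "h integrable_on {x..y}"
          using fi[OF ab(1) le ab(2)] gi[OF ab(1) le ab(2)] hi[OF ab(1) le ab(2)]
          by (auto simp: absolutely_integrable_on_def)
        \<comment> \<open>Each increment keeps one factor frozen at an endpoint. Subtracting
          \<open>h\<close> then leaves \<open>(F y - F t) * g t + (G x - G t) * f t\<close>, which
          the oscillation bounds \<open>Fy\<close> and \<open>Gx\<close> control.\<close>
        have "F y * G y - F x * G x = F y * (G y - G x) + G x * (F y - F x)"
          by (simp add: algebra_simps)
        also have "\<dots> = integral {x..y} (\<lambda>t. F y * g t + G x * f t)"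
          using AC_loc_derivD(2)[OF F ab(1) le ab(2)] AC_loc_derivD(2)[OF G ab(1) le ab(2)]
            has_integral_add[OF has_integral_mult_right has_integral_mult_right,
              OF integrable_integral[OF gI] integrable_integral[OF fI], THEN integral_unique]
          by simp
        also have "\<dots> - integral {x..y} h = integral {x..y} (\<lambda>t. F y * g t + G x * f t - h t)"
          using fI gI hI
          by (intro integral_diff[symmetric] integrable_on_mult_right integrable_add)
        also have "norm \<dots> \<le> integral {x..y} (\<lambda>t. \<epsilon> * v t)"
        proof (rule integral_norm_bound_integral)
          show "(\<lambda>t. F y * g t + G x * f t - h t) integrable_on {x..y}"
            using fI gI hI by (intro integrable_diff integrable_add integrable_on_mult_right)
          show "(\<lambda>t. \<epsilon> * v t) integrable_on {x..y}"
            by (intro integrable_on_mult_right vi ab le)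
          fix t assume t: "t \<in> {x..y}"
          have "F y * g t + G x * f t - h t = (F y - F t) * g t + (G x - G t) * f t"
            by (simp add: h_def algebra_simps)
          also have "norm \<dots> \<le> \<epsilon> * norm (g t) + \<epsilon> * norm (f t)"
            by (rule order_trans[OF norm_triangle_ineq])
              (use Fy[OF t] Gx[OF t] in \<open>auto simp: norm_mult intro!: add_mono mult_right_mono\<close>)
          finally show "norm (F y * g t + G x * f t - h t) \<le> \<epsilon> * v t"
            by (simp add: v_def algebra_simps)
        qed
        finally show "norm (F y * G y - F x * G x - integral {x..y} h) \<le> \<epsilon> * integral {x..y} v"
          by simp
      qed
    qed (use d1 d2 in auto)
  qed
  have v0: "integral {c..d} v \<ge> 0"
    using vi cd by (intro integral_nonneg) (auto simp: v_def)
  \<comment> \<open>The \<open>+ 1\<close> keeps the denominator positive even if \<open>f\<close>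
    and \<open>g\<close> vanish almost everywhere.\<close>
  have "norm (F d * G d - F c * G c - integral {c..d} h) \<le> 0 + e" if "e > 0" for e
  proof -
    have "norm (F d * G d - F c * G c - integral {c..d} h)
        \<le> e / (integral {c..d} v + 1) * integral {c..d} v"
      using bound[of "e / (integral {c..d} v + 1)"] that v0 cd by (simp add: P_def)
    also have "\<dots> \<le> e"
      using that v0 by (simp add: field_simps)
    finally show ?thesis by simp
  qed
  then have "norm (F d * G d - F c * G c - integral {c..d} h) \<le> 0"
    by (rule field_le_epsilon)
  then show "(\<lambda>x. F x * g x + G x * f x) absolutely_integrable_on {c..d} \<and>
      integral {c..d} (\<lambda>x. F x * g x + G x * f x) = F d * G d - F c * G c"
    using hi[OF cd] unfolding h_def by simp
qed

text \<open>Lebesgue differentiation: almost everywhere \<open>f x\<close> is the limit of its means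
  over \<open>[x, x + h]\<close>, and all these means are zero.\<close>

lemma AE_zero_if_interval_integrals_zero:
  fixes f :: "real \<Rightarrow> complex"
  assumes f: "f absolutely_integrable_on {a..b}"
    and zero: "\<And>x y. a \<le> x \<Longrightarrow> x \<le> y \<Longrightarrow> y \<le> b \<Longrightarrow> integral {x..y} f = 0"
  shows "AE x in lebesgue_on {a..b}. f x = 0"
proof -
  \<comment> \<open>Extension by zero gives a function integrable over every bounded interval, as
    the differentiation theorem on the line demands.\<close>
  define g where "g = (\<lambda>x. if x \<in> {a..b} then f x else 0)"
  have g: "g integrable_on cbox c d" for c d
  proof -
    have "f integrable_on {a..b} \<inter> cbox c d"
      using absolutely_integrable_on_subcbox[OF f, of "max a c" "min b d"]
      unfolding absolutely_integrable_on_def box_real Int_atLeastAtMost by simp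
    then show ?thesis
      unfolding g_def by (simp only: integrable_restrict_Int)
  qed
  obtain N where N: "negligible N" and
    lim: "\<And>x e. \<lbrakk>x \<notin> N; 0 < e\<rbrakk> \<Longrightarrow> \<exists>d>0. \<forall>h. 0 < h \<and> h < d \<longrightarrow>
        norm (integral (cbox x (x + h *\<^sub>R One)) g /\<^sub>R h ^ DIM(real) - g x) < e"
    using integrable_ccontinuous_explicit[of g] g by blast
  \<comment> \<open>The point \<open>b\<close> joins the exceptional set because the means are taken
    to the right of \<open>x\<close>.\<close>
  have "f x = 0" if "x \<in> {a..b} - (insert b N)" for x
  proof (rule ccontr)
    assume nz: "f x \<noteq> 0"
    have x: "a \<le> x" "x < b" "x \<notin> N" using that by auto
    obtain d where d: "d > 0" "\<And>h. 0 < h \<Longrightarrow> h < d \<Longrightarrow>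
        norm (integral (cbox x (x + h *\<^sub>R One)) g /\<^sub>R h ^ DIM(real) - g x) < norm (f x)"
      using lim[OF x(3), of "norm (f x)"] nz by auto
    define h where "h = min (d/2) (b - x)"
    have h: "0 < h" "h < d" "x + h \<le> b" using d x by (auto simp: h_def)
    have "integral (cbox x (x + h *\<^sub>R One)) g = integral {x..x+h} f"
      using h x by (auto simp: g_def intro!: integral_cong)
    also have "\<dots> = 0" using zero[of x "x+h"] h x by auto
    finally show False using d(2)[OF h(1,2)] x by (simp add: g_def)
  qed
  moreover have "negligible (insert b N)" using N by (simp add: negligible_insert)
  ultimately show ?thesis
    by (subst AE_lebesgue_on_iff_negligible) (simp, blast)
qed

text \<open>A nonempty open set is never null, so \<open>f\<close> has no nonzero value in the open
  interval, and the endpoints follow by closure. A degenerate interval would itself be null, hence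
  \<open>a < b\<close>.\<close>

lemma continuous_AE_zero_imp_zero:
  fixes f :: "real \<Rightarrow> complex"
  assumes "continuous_on {a..b} f" "AE x in lebesgue_on {a..b}. f x = 0" "a < b" "x \<in> {a..b}"
  shows "f x = 0"
proof -
  obtain N where N: "negligible N" "\<forall>x\<in>{a..b} - N. f x = 0"
    using assms(2) AE_lebesgue_on_iff_negligible[of "{a..b}"] by auto
  have zero: "f y = 0" if y: "y \<in> {a<..<b}" for y
  proof (rule ccontr)
    assume "f y \<noteq> 0"
    have "continuous_on {a<..<b} f"
      by (rule continuous_on_subset[OF assms(1)]) auto
    then have "open ({a<..<b} \<inter> f -` (-{0}))"
      by (intro continuous_open_preimage) auto
    moreover have "negligible ({a<..<b} \<inter> f -` (-{0}))"
      by (rule negligible_subset[OF N(1)]) (use N(2) in force)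
    ultimately show False
      using open_not_negligible \<open>f y \<noteq> 0\<close> y by blast
  qed
  have "f ` closure {a<..<b} \<subseteq> {0}"
    by (rule image_closure_subset) (use assms zero in auto)
  then have "f ` {a..b} \<subseteq> {0}" using assms by simp
  then show ?thesis using assms(4) by blast
qed

section \<open>Lagrange's identity and dependence on the spectral parameter\<close>

lemma sl_expr_subset:
  assumes "sl_expr I p q w y u f" "J \<subseteq> I" "I \<in> sets lebesgue" "J \<in> sets lebesgue"
  shows "sl_expr J p q w y u f"
proof -
  obtain y' u' where "AC_loc_deriv I y y'" "AC_loc_deriv I u u'"
    "AE x in lebesgue_on I. u x = p x * y' x"
    "AE x in lebesgue_on I. f x = 1 / of_real (w x) * (- u' x + q x * y x)"
    using assms(1) unfolding sl_expr_def by blast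
  then show ?thesis
    unfolding sl_expr_def using AC_loc_deriv_subset[OF _ assms(2)] AE_lebesgue_on_subset[OF _ assms(2-4)]
    by blast
qed

lemma sl_expr_lincomb:
  assumes "sl_expr I p q w y u f" "sl_expr I p q w z v g"
  shows "sl_expr I p q w (\<lambda>x. s * y x + t * z x) (\<lambda>x. s * u x + t * v x) (\<lambda>x. s * f x + t * g x)"
proof -
  obtain y' u' where y: "AC_loc_deriv I y y'" "AC_loc_deriv I u u'"
    "AE x in lebesgue_on I. u x = p x * y' x"
    "AE x in lebesgue_on I. f x = 1 / of_real (w x) * (- u' x + q x * y x)"
    using assms(1) unfolding sl_expr_def by blast
  obtain z' v' where z: "AC_loc_deriv I z z'" "AC_loc_deriv I v v'"
    "AE x in lebesgue_on I. v x = p x * z' x"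
    "AE x in lebesgue_on I. g x = 1 / of_real (w x) * (- v' x + q x * z x)"
    using assms(2) unfolding sl_expr_def by blast
  have "AE x in lebesgue_on I. s * u x + t * v x = p x * (s * y' x + t * z' x)"
    using y(3) z(3) by eventually_elim (simp add: algebra_simps)
  moreover have "AE x in lebesgue_on I. s * f x + t * g x =
      1 / of_real (w x) * (- (s * u' x + t * v' x) + q x * (s * y x + t * z x))"
    using y(4) z(4)
  proof eventually_elim
    case (elim x)
    show ?case unfolding elim by (simp add: divide_inverse algebra_simps)
  qed
  ultimately show ?thesis
    unfolding sl_expr_def using AC_loc_deriv_lincomb[OF y(1) z(1)] AC_loc_deriv_lincomb[OF y(2) z(2)]
    by blast
qed

lemma sl_expr_continuous:
  assumes "sl_expr {a..b} p q w y u f"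
  shows "continuous_on {a..b} y" "continuous_on {a..b} u"
  using assms AC_loc_deriv_continuous unfolding sl_expr_def by blast+

text \<open>The setting on a compact interval \<open>[a, T]\<close>; \<open>T\<close> will be a
  truncation point \<open>d n\<close>.\<close>

locale regular_sl =
  fixes a T :: real and p q :: "real \<Rightarrow> complex" and w :: "real \<Rightarrow> real"
  assumes aT: "a < T"
    and pw: "AE x in lebesgue_on {a..T}. 0 < w x \<and> p x \<noteq> 0"
    and w_int: "w absolutely_integrable_on {a..T}"
begin

lemma weighted_absolutely_integrable:
  assumes "continuous_on {a..T} f" "continuous_on {a..T} g" "x \<le> T"
  shows "(\<lambda>t. of_real (w t) * f t * g t :: complex) absolutely_integrable_on {a..x}"
proof -
  have "(\<lambda>t. complex_of_real (w t)) absolutely_integrable_on {a..T}"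
    using integrable_of_real[OF w_int[unfolded set_integrable_def], where 'a = complex]
    by (simp add: set_integrable_def scaleR_conv_of_real)
  then have "(\<lambda>t. (f t * g t) * of_real (w t)) absolutely_integrable_on {a..T}"
    by (intro continuous_mult_absolutely_integrable continuous_intros assms)
  then have "(\<lambda>t. (f t * g t) * of_real (w t)) absolutely_integrable_on {a..x}"
    by (rule absolutely_integrable_on_subcbox) (use assms in auto)
  then show ?thesis by (simp add: mult_ac)
qed

lemma weighted_integral_bound:
  fixes f g :: "real \<Rightarrow> complex"
  assumes "continuous_on {a..T} f" "continuous_on {a..T} g" "x \<in> {a..T}"
    and f: "\<And>t. t \<in> {a..T} \<Longrightarrow> norm (f t) \<le> A" and g: "\<And>t. t \<in> {a..T} \<Longrightarrow> norm (g t) \<le> B"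
  shows "norm (integral {a..x} (\<lambda>t. of_real (w t) * f t * g t)) \<le> A * B * integral {a..T} (\<lambda>t. \<bar>w t\<bar>)"
proof -
  have A: "0 \<le> A" and B: "0 \<le> B"
    using order_trans[OF norm_ge_zero f[of a]] order_trans[OF norm_ge_zero g[of a]] aT by simp_all
  have wi: "(\<lambda>t. \<bar>w t\<bar>) integrable_on {a..T}"
    using w_int by (simp add: absolutely_integrable_on_def)
  have wx: "(\<lambda>t. \<bar>w t\<bar>) integrable_on {a..x}"
    by (rule integrable_on_subinterval[OF wi]) (use assms in auto)
  have "norm (integral {a..x} (\<lambda>t. of_real (w t) * f t * g t)) \<le> integral {a..x} (\<lambda>t. A * B * \<bar>w t\<bar>)"
  proof (rule integral_norm_bound_integral)
    show "(\<lambda>t. of_real (w t) * f t * g t) integrable_on {a..x}"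
      using weighted_absolutely_integrable[OF assms(1,2), of x] assms(3) absolutely_integrable_on_def by auto
    show "(\<lambda>t. A * B * \<bar>w t\<bar>) integrable_on {a..x}"
      by (intro integrable_on_mult_right wx)
    fix t assume "t \<in> {a..x}"
    then have "t \<in> {a..T}" using assms(3) by auto
    then have "norm (f t) * norm (g t) \<le> A * B"
      by (intro mult_mono f g A) auto
    then have "(norm (f t) * norm (g t)) * \<bar>w t\<bar> \<le> A * B * \<bar>w t\<bar>"
      by (rule mult_right_mono) simp
    moreover have "norm (of_real (w t) * f t * g t) = (norm (f t) * norm (g t)) * \<bar>w t\<bar>"
      by (simp add: norm_mult)
    ultimately show "norm (of_real (w t) * f t * g t) \<le> A * B * \<bar>w t\<bar>"
      by simp
  qed
  also have "\<dots> = A * B * integral {a..x} (\<lambda>t. \<bar>w t\<bar>)"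
    by simp
  also have "\<dots> \<le> A * B * integral {a..T} (\<lambda>t. \<bar>w t\<bar>)"
    using assms(3) wi wx A B by (intro mult_left_mono integral_subset_le mult_nonneg_nonneg) auto
  finally show ?thesis .
qed

text \<open>Lagrange's identity. In the derivative of \<open>y * v - u * z\<close> the terms
  \<open>v * y'\<close> and \<open>u * z'\<close> are both \<open>p * y' * z'\<close> and cancel;
  the equations turn the rest into \<open>(lam - mu) * w * y * z\<close>.\<close>

lemma wronskian_identity:
  assumes "sl_solution {a..T} p q w lam y u" "sl_solution {a..T} p q w mu z v" "x \<in> {a..T}"
  shows "y x * v x - u x * z x =
    y a * v a - u a * z a + (lam - mu) * integral {a..x} (\<lambda>t. of_real (w t) * y t * z t)"
proof -
  obtain y' u' where y: "AC_loc_deriv {a..T} y y'" "AC_loc_deriv {a..T} u u'"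
    "AE x in lebesgue_on {a..T}. u x = p x * y' x"
    "AE x in lebesgue_on {a..T}. lam * y x = 1 / of_real (w x) * (- u' x + q x * y x)"
    using assms(1) unfolding sl_solution_def sl_expr_def by blast
  obtain z' v' where z: "AC_loc_deriv {a..T} z z'" "AC_loc_deriv {a..T} v v'"
    "AE x in lebesgue_on {a..T}. v x = p x * z' x"
    "AE x in lebesgue_on {a..T}. mu * z x = 1 / of_real (w x) * (- v' x + q x * z x)"
    using assms(2) unfolding sl_solution_def sl_expr_def by blast
  let ?h = "\<lambda>t. 1 * (y t * v' t + v t * y' t) + (-1) * (u t * z' t + z t * u' t)"
  have "AC_loc_deriv {a..T} (\<lambda>t. 1 * (y t * v t) + (-1) * (u t * z t)) ?h"
    by (intro AC_loc_deriv_lincomb AC_loc_deriv_mult y z)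
  from AC_loc_derivD(2)[OF this order_refl, of x]
  have h: "integral {a..x} ?h = y x * v x - u x * z x - (y a * v a - u a * z a)"
    using assms(3) by simp
  have "integral {a..x} ?h = integral {a..x} (\<lambda>t. (lam - mu) * (of_real (w t) * y t * z t))"
  proof (rule integral_cong_AE_lebesgue_on)
    have "AE t in lebesgue_on {a..T}. ?h t = (lam - mu) * (of_real (w t) * y t * z t)"
      using y(3,4) z(3,4) pw
    proof eventually_elim
      case (elim t)
      then have u': "u' t = q t * y t - lam * of_real (w t) * y t"
        and v': "v' t = q t * z t - mu * of_real (w t) * z t"
        by (auto simp: field_simps)
      then show ?case
        unfolding elim(1) elim(3) u' v' by (simp add: algebra_simps)
    qed
    then show "AE t in lebesgue_on {a..x}. ?h t = (lam - mu) * (of_real (w t) * y t * z t)"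
      by (rule AE_lebesgue_on_subset) (use assms(3) in auto)
  qed auto
  then have "(lam - mu) * integral {a..x} (\<lambda>t. of_real (w t) * y t * z t) = integral {a..x} ?h"
    by simp
  then show ?thesis unfolding h by simp
qed

text \<open>Once \<open>y\<close> vanishes everywhere by continuity, its derivative has zero
  integral over every subinterval, so it is zero a.e.; then \<open>u = p * y'\<close> is zero a.e.
  and, being continuous, everywhere. Hence nonzero initial data exclude the zero class.\<close>

lemma sl_expr_AE_zero_imp_zero:
  assumes "sl_expr {a..T} p q w y u f" "AE x in lebesgue_on {a..T}. y x = 0" "x \<in> {a..T}"
  shows "y x = 0" "u x = 0"
proof -
  have y0: "y x = 0" if "x \<in> {a..T}" for x
    using continuous_AE_zero_imp_zero[OF sl_expr_continuous(1)[OF assms(1)] assms(2) aT that] .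
  obtain y' where y: "AC_loc_deriv {a..T} y y'" "AE x in lebesgue_on {a..T}. u x = p x * y' x"
    using assms(1) unfolding sl_expr_def by blast
  have "AE x in lebesgue_on {a..T}. y' x = 0"
  proof (rule AE_zero_if_interval_integrals_zero)
    show "y' absolutely_integrable_on {a..T}"
      using AC_loc_derivD(1)[OF y(1)] aT by simp
    show "integral {x..z} y' = 0" if "a \<le> x" "x \<le> z" "z \<le> T" for x z
      using AC_loc_derivD(2)[OF y(1) that] y0 that by simp
  qed
  with y(2) have "AE x in lebesgue_on {a..T}. u x = 0"
    by eventually_elim simp
  then show "u x = 0"
    using continuous_AE_zero_imp_zero[OF sl_expr_continuous(2)[OF assms(1)] _ aT assms(3)] by simp
  show "y x = 0" by (rule y0[OF assms(3)])
qed

end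

locale sl_fundamental = regular_sl +
  fixes \<theta> \<theta>1 \<phi> \<phi>1 :: "complex \<Rightarrow> real \<Rightarrow> complex" and \<alpha> :: complex
  assumes theta: "\<And>lam. sl_solution {a..T} p q w lam (\<theta> lam) (\<theta>1 lam)"
    and theta_a: "\<And>lam. \<theta> lam a = cos \<alpha>" "\<And>lam. \<theta>1 lam a = sin \<alpha>"
    and phi: "\<And>lam. sl_solution {a..T} p q w lam (\<phi> lam) (\<phi>1 lam)"
    and phi_a: "\<And>lam. \<phi> lam a = sin \<alpha>" "\<And>lam. \<phi>1 lam a = - cos \<alpha>"
begin

lemma solution_continuous:
  assumes "sl_solution {a..T} p q w lam y u"
  shows "continuous_on {a..T} y" "continuous_on {a..T} u"
  using assms sl_expr_continuous unfolding sl_solution_def by blast+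

lemmas fundamental_continuous =
  solution_continuous[OF theta] solution_continuous[OF phi]

lemma wronskian_fundamental:
  assumes "x \<in> {a..T}"
  shows "\<theta> mu x * \<phi>1 mu x - \<theta>1 mu x * \<phi> mu x = - 1"
proof -
  have "cos \<alpha> * (- cos \<alpha>) - sin \<alpha> * sin \<alpha> = - 1"
    using sin_cos_squared_add3[of \<alpha>] by algebra
  then show ?thesis
    using wronskian_identity[OF theta phi assms, of mu mu] unfolding theta_a phi_a by simp
qed

text \<open>Lagrange's identity against \<open>\<theta> mu\<close> and \<open>\<phi> mu\<close>
  gives two linear equations for the differences \<open>y - z\<close> and \<open>u - v\<close>,
  solved with the Wronskian \<open>- 1\<close>. Since \<open>z\<close> has the same parameter
  \<open>mu\<close>, it contributes no integral; what results is an integral equation for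
  \<open>y\<close> with the small factor \<open>lam - mu\<close>.\<close>

lemma variation_of_constants:
  assumes y: "sl_solution {a..T} p q w lam y u" and z: "sl_solution {a..T} p q w mu z v"
    and init: "y a = z a" "u a = v a" and x: "x \<in> {a..T}"
  defines "A \<equiv> integral {a..x} (\<lambda>t. of_real (w t) * y t * \<theta> mu t)"
    and "B \<equiv> integral {a..x} (\<lambda>t. of_real (w t) * y t * \<phi> mu t)"
  shows "y x - z x = (lam - mu) * (\<phi> mu x * A - \<theta> mu x * B)"
    and "u x - v x = (lam - mu) * (\<phi>1 mu x * A - \<theta>1 mu x * B)"
proof -
  define Y U where "Y = y x - z x" and "U = u x - v x"
  have "Y * \<theta>1 mu x - U * \<theta> mu x =
      (y x * \<theta>1 mu x - u x * \<theta> mu x) - (z x * \<theta>1 mu x - v x * \<theta> mu x)"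
    by (simp add: Y_def U_def algebra_simps)
  then have A: "Y * \<theta>1 mu x - U * \<theta> mu x = (lam - mu) * A"
    unfolding wronskian_identity[OF y theta x] wronskian_identity[OF z theta x] init A_def by simp
  have "Y * \<phi>1 mu x - U * \<phi> mu x =
      (y x * \<phi>1 mu x - u x * \<phi> mu x) - (z x * \<phi>1 mu x - v x * \<phi> mu x)"
    by (simp add: Y_def U_def algebra_simps)
  then have B: "Y * \<phi>1 mu x - U * \<phi> mu x = (lam - mu) * B"
    unfolding wronskian_identity[OF y phi x] wronskian_identity[OF z phi x] init B_def by simp
  note W = wronskian_fundamental[OF x, of mu]
  have "(lam - mu) * (\<phi> mu x * A - \<theta> mu x * B) =
      - Y * (\<theta> mu x * \<phi>1 mu x - \<theta>1 mu x * \<phi> mu x)"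
    unfolding right_diff_distrib mult.left_commute[of "lam - mu"] A[symmetric] B[symmetric]
    by (simp add: algebra_simps)
  then show "y x - z x = (lam - mu) * (\<phi> mu x * A - \<theta> mu x * B)"
    unfolding W by (simp add: Y_def)
  have "(lam - mu) * (\<phi>1 mu x * A - \<theta>1 mu x * B) =
      - U * (\<theta> mu x * \<phi>1 mu x - \<theta>1 mu x * \<phi> mu x)"
    unfolding right_diff_distrib mult.left_commute[of "lam - mu"] A[symmetric] B[symmetric]
    by (simp add: algebra_simps)
  then show "u x - v x = (lam - mu) * (\<phi>1 mu x * A - \<theta>1 mu x * B)"
    unfolding W by (simp add: U_def)
qed

section \<open>Continuous and holomorphic dependence on the spectral parameter\<close>

lemma continuous_bound:
  fixes f :: "real \<Rightarrow> complex"
  assumes "continuous_on {a..T} f"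
  obtains B where "B > 0" "\<And>t. t \<in> {a..T} \<Longrightarrow> norm (f t) \<le> B"
proof -
  have "bounded (f ` {a..T})"
    by (intro compact_imp_bounded compact_continuous_image assms) auto
  then show ?thesis
    using that unfolding bounded_pos by blast
qed

text \<open>For \<open>lam\<close> near \<open>mu\<close> the integral term of variation of
  constants is at most half the maximum of \<open>\<bar>y lam\<bar>\<close>. Absorbing it yields
  first an a priori bound on \<open>y lam\<close> and then the closeness to
  \<open>y mu\<close>.\<close>

lemma solution_uniformly_continuous_in_parameter:
  assumes y: "\<And>lam. sl_solution {a..T} p q w lam (y lam) (u lam)"
    and init: "\<And>lam. y lam a = y0" "\<And>lam. u lam a = u0" and e: "\<epsilon> > 0"
  shows "\<forall>\<^sub>F lam in nhds mu. \<forall>x\<in>{a..T}. norm (y lam x - y mu x) \<le> \<epsilon>"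
proof -
  obtain P where P: "P > 0" "\<And>t. t \<in> {a..T} \<Longrightarrow> norm (\<phi> mu t) \<le> P"
    using continuous_bound[OF fundamental_continuous(3)] by metis
  obtain Q where Q: "Q > 0" "\<And>t. t \<in> {a..T} \<Longrightarrow> norm (\<theta> mu t) \<le> Q"
    using continuous_bound[OF fundamental_continuous(1)] by metis
  obtain Y where Y: "Y > 0" "\<And>t. t \<in> {a..T} \<Longrightarrow> norm (y mu t) \<le> Y"
    using continuous_bound[OF solution_continuous(1)[OF y]] by metis
  define V where "V = integral {a..T} (\<lambda>t. \<bar>w t\<bar>)"
  have V: "V \<ge> 0" unfolding V_def
    using w_int by (intro integral_nonneg) (auto simp: absolutely_integrable_on_def)
  \<comment> \<open>Bound for the integral operator: each of the two products in
    \<open>\<phi> mu * A - \<theta> mu * B\<close> contributes \<open>P * Q * V\<close>.\<close>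
  define C where "C = 2 * P * Q * V"
  have C: "C \<ge> 0" using P Q V by (simp add: C_def)
  \<comment> \<open>The first entry gives the factor \<open>1/2\<close> for the absorption; the
    second turns the final bound \<open>norm (lam - mu) * C * (2 * Y)\<close> into \<epsilon>. The
    \<open>+ 1\<close> covers \<open>C = 0\<close>.\<close>
  define \<delta> where "\<delta> = min (1 / (2 * (C + 1))) (\<epsilon> / (2 * Y * (C + 1)))"
  have \<delta>: "\<delta> > 0" using C Y e by (simp add: \<delta>_def)
  show ?thesis
    unfolding eventually_nhds_metric
  proof (intro exI[of _ \<delta>] conjI allI impI ballI \<delta>)
    fix lam x assume "dist lam mu < \<delta>" and x: "x \<in> {a..T}"
    then have d: "norm (lam - mu) < 1 / (2 * (C + 1))" "norm (lam - mu) < \<epsilon> / (2 * Y * (C + 1))"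
      by (auto simp: \<delta>_def dist_norm)
    obtain x0 where x0: "x0 \<in> {a..T}" "\<And>t. t \<in> {a..T} \<Longrightarrow> norm (y lam t) \<le> norm (y lam x0)"
      using continuous_attains_sup[of "{a..T}" "\<lambda>t. norm (y lam t)"] solution_continuous(1)[OF y] aT
      by (metis atLeastatMost_empty_iff2 compact_Icc continuous_on_norm less_le_not_le)
    have diff: "norm (y lam t - y mu t) \<le> norm (lam - mu) * C * norm (y lam x0)" if t: "t \<in> {a..T}" for t
    proof -
      let ?A = "integral {a..t} (\<lambda>s. of_real (w s) * y lam s * \<theta> mu s)"
      let ?B = "integral {a..t} (\<lambda>s. of_real (w s) * y lam s * \<phi> mu s)"
      have A: "norm ?A \<le> norm (y lam x0) * Q * V" and B: "norm ?B \<le> norm (y lam x0) * P * V"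
        unfolding V_def
        by (intro weighted_integral_bound solution_continuous(1)[OF y] fundamental_continuous t x0(2) P Q; assumption)+
      have "norm (\<phi> mu t * ?A - \<theta> mu t * ?B) \<le> norm (\<phi> mu t) * norm ?A + norm (\<theta> mu t) * norm ?B"
        using norm_triangle_ineq4[of "\<phi> mu t * ?A" "\<theta> mu t * ?B"] by (simp only: norm_mult)
      also have "\<dots> \<le> P * (norm (y lam x0) * Q * V) + Q * (norm (y lam x0) * P * V)"
        using P(2)[OF t] Q(2)[OF t] P(1) Q(1) by (intro add_mono mult_mono A B) auto
      also have "\<dots> = C * norm (y lam x0)"
        by (simp add: C_def)
      finally have "norm (\<phi> mu t * ?A - \<theta> mu t * ?B) \<le> C * norm (y lam x0)" .
      then show ?thesis
        using variation_of_constants(1)[OF y y _ _ t, of lam mu] init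
        by (simp add: norm_mult mult.assoc mult_left_mono)
    qed
    have half: "norm (lam - mu) * C \<le> 1 / 2"
    proof -
      have "norm (lam - mu) * C \<le> 1 / (2 * (C + 1)) * (C + 1)"
        using d(1) C by (intro mult_mono) auto
      also have "\<dots> = 1 / 2" using C by (simp add: field_simps)
      finally show ?thesis .
    qed
    have "norm (y lam x0) \<le> norm (y mu x0) + norm (y lam x0 - y mu x0)"
      by (rule norm_triangle_sub)
    also have "\<dots> \<le> Y + 1 / 2 * norm (y lam x0)"
      using Y(2)[OF x0(1)] diff[OF x0(1)] mult_right_mono[OF half, of "norm (y lam x0)"] by simp
    finally have y2: "norm (y lam x0) \<le> 2 * Y" by simp
    have "norm (y lam x - y mu x) \<le> norm (lam - mu) * C * (2 * Y)"
      by (rule order_trans[OF diff[OF x]]) (use y2 C in \<open>intro mult_left_mono, auto\<close>)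
    also have "\<dots> \<le> \<epsilon> / (2 * Y * (C + 1)) * (C + 1) * (2 * Y)"
      using d(2) C Y(1) e by (intro mult_mono) auto
    also have "\<dots> = \<epsilon>" using C Y(1) by simp
    finally show "norm (y lam x - y mu x) \<le> \<epsilon>" .
  qed
qed

text \<open>By variation of constants the difference quotient equals
  \<open>\<phi> mu T * ?A lam - \<theta> mu T * ?B lam\<close> exactly, and likewise for
  \<open>u\<close>. The integrals \<open>?A\<close> and \<open>?B\<close> converge as
  \<open>lam\<close> tends to \<open>mu\<close> because \<open>y lam\<close> does so uniformly on
  the interval.\<close>

lemma solution_differentiable_in_parameter:
  assumes y: "\<And>lam. sl_solution {a..T} p q w lam (y lam) (u lam)"
    and init: "\<And>lam. y lam a = y0" "\<And>lam. u lam a = u0"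
  shows "(\<lambda>lam. y lam T) field_differentiable at mu" "(\<lambda>lam. u lam T) field_differentiable at mu"
proof -
  have lim: "((\<lambda>lam. integral {a..T} (\<lambda>t. of_real (w t) * y lam t * g t)) \<longlongrightarrow>
      integral {a..T} (\<lambda>t. of_real (w t) * y mu t * g t)) (at mu)"
    if g: "continuous_on {a..T} g" for g
  proof (rule tendstoI)
    fix e :: real assume e: "e > 0"
    obtain B where B: "B > 0" "\<And>t. t \<in> {a..T} \<Longrightarrow> norm (g t) \<le> B"
      using continuous_bound[OF g] by metis
    define V where "V = integral {a..T} (\<lambda>t. \<bar>w t\<bar>)"
    have V: "V \<ge> 0" unfolding V_def
      using w_int by (intro integral_nonneg) (auto simp: absolutely_integrable_on_def)
    define d where "d = e / (B * (V + 1))"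
    have d: "d > 0" using e B V by (simp add: d_def)
    have "\<forall>\<^sub>F lam in at mu. \<forall>x\<in>{a..T}. norm (y lam x - y mu x) \<le> d"
      using solution_uniformly_continuous_in_parameter[OF y init d, of mu]
      by (simp add: eventually_at_filter eventually_mono)
    then show "\<forall>\<^sub>F lam in at mu. dist (integral {a..T} (\<lambda>t. of_real (w t) * y lam t * g t))
        (integral {a..T} (\<lambda>t. of_real (w t) * y mu t * g t)) < e"
    proof eventually_elim
      case (elim lam)
      have int: "(\<lambda>t. of_real (w t) * y l t * g t) integrable_on {a..T}" for l
        using weighted_absolutely_integrable[OF solution_continuous(1)[OF y] g order_refl]
          absolutely_integrable_on_def by blast
      have "integral {a..T} (\<lambda>t. of_real (w t) * y lam t * g t) - integral {a..T} (\<lambda>t. of_real (w t) * y mu t * g t)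
          = integral {a..T} (\<lambda>t. of_real (w t) * (y lam t - y mu t) * g t)"
        by (subst integral_diff[symmetric, OF int int]) (simp add: algebra_simps)
      also have "norm \<dots> \<le> d * B * V"
        unfolding V_def using elim B aT
        by (intro weighted_integral_bound continuous_intros g solution_continuous(1)[OF y]) auto
      also have "\<dots> < d * B * (V + 1)"
        using d B by (intro mult_strict_left_mono) auto
      also have "\<dots> = e" using B V by (simp add: d_def)
      finally show ?case by (simp add: dist_norm)
    qed
  qed
  let ?A = "\<lambda>lam. integral {a..T} (\<lambda>t. of_real (w t) * y lam t * \<theta> mu t)"
  let ?B = "\<lambda>lam. integral {a..T} (\<lambda>t. of_real (w t) * y lam t * \<phi> mu t)"
  have T: "T \<in> {a..T}" using aT by simp
  have eq: "(y lam T - y mu T) / (lam - mu) = \<phi> mu T * ?A lam - \<theta> mu T * ?B lam"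
    "(u lam T - u mu T) / (lam - mu) = \<phi>1 mu T * ?A lam - \<theta>1 mu T * ?B lam"
    if "lam \<noteq> mu" for lam
    using variation_of_constants[OF y y _ _ T, of lam mu] init that by simp_all
  have "((\<lambda>lam. \<phi> mu T * ?A lam - \<theta> mu T * ?B lam) \<longlongrightarrow> \<phi> mu T * ?A mu - \<theta> mu T * ?B mu) (at mu)"
    "((\<lambda>lam. \<phi>1 mu T * ?A lam - \<theta>1 mu T * ?B lam) \<longlongrightarrow> \<phi>1 mu T * ?A mu - \<theta>1 mu T * ?B mu) (at mu)"
    by (intro tendsto_intros lim fundamental_continuous)+
  then have "((\<lambda>lam. (y lam T - y mu T) / (lam - mu)) \<longlongrightarrow> \<phi> mu T * ?A mu - \<theta> mu T * ?B mu) (at mu)"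
    "((\<lambda>lam. (u lam T - u mu T) / (lam - mu)) \<longlongrightarrow> \<phi>1 mu T * ?A mu - \<theta>1 mu T * ?B mu) (at mu)"
    using eq by (auto elim!: Lim_transform_eventually simp: eventually_at_filter)
  then show "(\<lambda>lam. y lam T) field_differentiable at mu" "(\<lambda>lam. u lam T) field_differentiable at mu"
    unfolding field_differentiable_def has_field_derivative_iff by blast+
qed

lemmas theta_differentiable = solution_differentiable_in_parameter[OF theta theta_a]
lemmas phi_differentiable = solution_differentiable_in_parameter[OF phi phi_a]

end

section \<open>Weighted square-integrable functions\<close>

lemma L2w_norm_power2:
  assumes "AE x in lebesgue_on I. 0 < w x"
  shows "(L2w_norm I w f)\<^sup>2 = (\<integral>x. (cmod (f x))\<^sup>2 * w x \<partial>lebesgue_on I)"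
proof -
  have "0 \<le> (\<integral>x. (cmod (f x))\<^sup>2 * w x \<partial>lebesgue_on I)"
  proof (rule integral_nonneg_AE)
    show "AE x in lebesgue_on I. 0 \<le> (cmod (f x))\<^sup>2 * w x"
      using assms by eventually_elim simp
  qed
  then show ?thesis by (simp add: L2w_norm_def)
qed

lemma L2w_cmult:
  assumes "f \<in> L2w I w"
  shows "(\<lambda>x. c * f x) \<in> L2w I w"
  using assms unfolding L2w_def
  by (auto simp: norm_mult power_mult_distrib mult.assoc)

lemma L2w_norm_cmult:
  assumes "AE x in lebesgue_on I. 0 < w x"
  shows "(L2w_norm I w (\<lambda>x. c * f x))\<^sup>2 = (cmod c)\<^sup>2 * (L2w_norm I w f)\<^sup>2"
  unfolding L2w_norm_power2[OF assms] by (simp add: norm_mult power_mult_distrib mult.assoc)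

text \<open>This pointwise inequality, integrated against \<open>w\<close>, serves as the triangle
  inequality for squared norms in all later estimates.\<close>

lemma norm_add_power2_le:
  fixes x y :: complex
  shows "(cmod (x + y))\<^sup>2 \<le> 2 * (cmod x)\<^sup>2 + 2 * (cmod y)\<^sup>2"
proof -
  have "(cmod (x + y))\<^sup>2 \<le> (cmod x + cmod y)\<^sup>2"
    by (intro power_mono norm_triangle_ineq) simp
  also have "\<dots> \<le> 2 * (cmod x)\<^sup>2 + 2 * (cmod y)\<^sup>2"
    using zero_le_power2[of "cmod x - cmod y"] by (simp add: power2_eq_square algebra_simps)
  finally show ?thesis .
qed

lemma L2w_add:
  assumes w: "AE x in lebesgue_on I. 0 < w x" and f: "f \<in> L2w I w" and g: "g \<in> L2w I w"
  shows "(\<lambda>x. f x + g x) \<in> L2w I w"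
    and "(L2w_norm I w (\<lambda>x. f x + g x))\<^sup>2 \<le> 2 * (L2w_norm I w f)\<^sup>2 + 2 * (L2w_norm I w g)\<^sup>2"
proof -
  let ?M = "lebesgue_on I"
  have [measurable]: "f \<in> borel_measurable ?M" "g \<in> borel_measurable ?M"
    and int: "integrable ?M (\<lambda>x. (cmod (f x))\<^sup>2 * w x)" "integrable ?M (\<lambda>x. (cmod (g x))\<^sup>2 * w x)"
    using f g by (auto simp: L2w_def)
  have [measurable]: "(\<lambda>x. (cmod (f x))\<^sup>2 * w x) \<in> borel_measurable ?M"
    "(\<lambda>x. (cmod (g x))\<^sup>2 * w x) \<in> borel_measurable ?M"
    using int by auto
  let ?b = "\<lambda>x. 2 * ((cmod (f x))\<^sup>2 * w x) + 2 * ((cmod (g x))\<^sup>2 * w x)"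
  have b: "integrable ?M ?b"
    using int by auto
  \<comment> \<open>\<open>w\<close> itself is not assumed to be measurable, so it must not be separated from \<open>\<bar>f\<bar>\<^sup>2 w\<close>.\<close>
  have eq: "(cmod (f x + g x))\<^sup>2 * w x = (if f x = 0 then (cmod (g x))\<^sup>2 * w x
      else (cmod (f x + g x))\<^sup>2 / (cmod (f x))\<^sup>2 * ((cmod (f x))\<^sup>2 * w x))" for x
    by simp
  have meas: "(\<lambda>x. (cmod (f x + g x))\<^sup>2 * w x) \<in> borel_measurable ?M"
    unfolding eq by measurable
  have le: "AE x in ?M. (cmod (f x + g x))\<^sup>2 * w x \<le> ?b x"
    using w
  proof eventually_elim
    case (elim x)
    have "(cmod (f x + g x))\<^sup>2 * w x \<le> (2 * (cmod (f x))\<^sup>2 + 2 * (cmod (g x))\<^sup>2) * w x"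
      by (rule mult_right_mono[OF norm_add_power2_le]) (use elim in simp)
    then show ?case by (simp add: algebra_simps)
  qed
  have int': "integrable ?M (\<lambda>x. (cmod (f x + g x))\<^sup>2 * w x)"
  proof (rule Bochner_Integration.integrable_bound[OF b meas])
    show "AE x in ?M. norm ((cmod (f x + g x))\<^sup>2 * w x) \<le> norm (?b x)"
      using le w by eventually_elim (simp add: abs_mult)
  qed
  then show "(\<lambda>x. f x + g x) \<in> L2w I w"
    by (simp add: L2w_def)
  have "(\<integral>x. (cmod (f x + g x))\<^sup>2 * w x \<partial>?M) \<le> (\<integral>x. ?b x \<partial>?M)"
    by (rule integral_mono_AE[OF int' b le])
  also have "\<dots> = 2 * (\<integral>x. (cmod (f x))\<^sup>2 * w x \<partial>?M) + 2 * (\<integral>x. (cmod (g x))\<^sup>2 * w x \<partial>?M)"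
    using int by simp
  finally show "(L2w_norm I w (\<lambda>x. f x + g x))\<^sup>2 \<le> 2 * (L2w_norm I w f)\<^sup>2 + 2 * (L2w_norm I w g)\<^sup>2"
    unfolding L2w_norm_power2[OF w] .
qed

lemma L2w_subset:
  assumes w: "AE x in lebesgue_on I. 0 < w x" and f: "f \<in> L2w I w"
    and J: "J \<subseteq> I" "I \<in> sets lebesgue" "J \<in> sets lebesgue"
  shows "f \<in> L2w J w" "(L2w_norm J w f)\<^sup>2 \<le> (L2w_norm I w f)\<^sup>2"
proof -
  let ?h = "\<lambda>x. (cmod (f x))\<^sup>2 * w x"
  have I: "integrable lebesgue (\<lambda>x. indicator I x *\<^sub>R ?h x)"
    using f J by (subst integrable_restrict_space[symmetric]) (auto simp: L2w_def)
  have "set_integrable lebesgue J ?h"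
    by (rule set_integrable_subset[of _ I]) (use I J in \<open>auto simp: set_integrable_def\<close>)
  then have Jint: "integrable lebesgue (\<lambda>x. indicator J x *\<^sub>R ?h x)"
    by (simp add: set_integrable_def)
  then have "integrable (lebesgue_on J) ?h"
    using J by (subst integrable_restrict_space) auto
  moreover have "f \<in> borel_measurable (lebesgue_on J)"
    by (rule measurable_restrict_mono[OF _ J(1)]) (use f in \<open>simp add: L2w_def\<close>)
  ultimately show "f \<in> L2w J w" by (simp add: L2w_def)
  have "AE x in lebesgue. x \<in> I \<longrightarrow> 0 < w x"
    using w J by (subst (asm) AE_restrict_space_iff) auto
  then have "AE x in lebesgue. indicator J x *\<^sub>R ?h x \<le> indicator I x *\<^sub>R ?h x"
    by eventually_elim (use J in \<open>auto simp: indicator_def\<close>)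
  then have "(\<integral>x. indicator J x *\<^sub>R ?h x \<partial>lebesgue) \<le> (\<integral>x. indicator I x *\<^sub>R ?h x \<partial>lebesgue)"
    by (rule integral_mono_AE[OF Jint I])
  then have "(\<integral>x. ?h x \<partial>lebesgue_on J) \<le> (\<integral>x. ?h x \<partial>lebesgue_on I)"
    using J by (simp add: integral_restrict_space)
  then show "(L2w_norm J w f)\<^sup>2 \<le> (L2w_norm I w f)\<^sup>2"
    unfolding L2w_norm_power2[OF w] L2w_norm_power2[OF AE_lebesgue_on_subset[OF w J]] .
qed

context regular_sl
begin

lemma w_pos: "AE x in lebesgue_on {a..T}. 0 < w x"
  using pw by eventually_elim simp

lemma continuous_L2w:
  assumes "continuous_on {a..T} f"
  shows "f \<in> L2w {a..T} w"
proof -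
  have "(\<lambda>x. (cmod (f x))\<^sup>2) \<in> borel_measurable (lebesgue_on {a..T})"
    by (intro continuous_imp_measurable_on_sets_lebesgue continuous_intros assms) auto
  moreover have "bounded ((\<lambda>x. (cmod (f x))\<^sup>2) ` {a..T})"
    by (intro compact_imp_bounded compact_continuous_image continuous_intros assms) auto
  ultimately have "(\<lambda>x. (cmod (f x))\<^sup>2 * w x) absolutely_integrable_on {a..T}"
    by (intro absolutely_integrable_bounded_measurable_product_real w_int) auto
  then have "integrable (lebesgue_on {a..T}) (\<lambda>x. (cmod (f x))\<^sup>2 * w x)"
    by (rule absolutely_integrable_imp_integrable) auto
  moreover have "f \<in> borel_measurable (lebesgue_on {a..T})"
    by (rule continuous_imp_measurable_on_sets_lebesgue[OF assms]) auto
  ultimately show ?thesis by (simp add: L2w_def)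
qed

lemma L2w_norm_le_sup:
  assumes "continuous_on {a..T} f" "\<And>t. t \<in> {a..T} \<Longrightarrow> norm (f t) \<le> B"
  shows "(L2w_norm {a..T} w f)\<^sup>2 \<le> B\<^sup>2 * (L2w_norm {a..T} w (\<lambda>_. 1))\<^sup>2"
proof -
  have f: "integrable (lebesgue_on {a..T}) (\<lambda>x. (cmod (f x))\<^sup>2 * w x)"
    and one: "integrable (lebesgue_on {a..T}) (\<lambda>x. (cmod 1)\<^sup>2 * w x)"
    using continuous_L2w[OF assms(1)] continuous_L2w[of "\<lambda>_. 1"] by (auto simp: L2w_def)
  have "AE x in lebesgue_on {a..T}. x \<in> {a..T}"
    using AE_space[of "lebesgue_on {a..T}"] by simp
  with w_pos have "AE x in lebesgue_on {a..T}. (cmod (f x))\<^sup>2 * w x \<le> B\<^sup>2 * ((cmod 1)\<^sup>2 * w x)"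
  proof eventually_elim
    case (elim x)
    then have "(cmod (f x))\<^sup>2 \<le> B\<^sup>2" by (intro power_mono assms) auto
    then show ?case using elim by simp
  qed
  then have "(\<integral>x. (cmod (f x))\<^sup>2 * w x \<partial>lebesgue_on {a..T}) \<le>
      (\<integral>x. B\<^sup>2 * ((cmod 1)\<^sup>2 * w x) \<partial>lebesgue_on {a..T})"
    by (intro integral_mono_AE f integrable_mult_right one)
  then show ?thesis
    unfolding L2w_norm_power2[OF w_pos] by simp
qed

text \<open>A vanishing norm forces \<open>y = 0\<close> a.e. since \<open>w > 0\<close> a.e., hence
  zero initial data. Applied to \<open>\<phi> \<mu>\<close>, this supplies the lower bound by which
  the Weyl coefficient is controlled.\<close>

lemma L2w_norm_solution_pos:
  assumes y: "sl_expr {a..T} p q w y u f" and nz: "y a \<noteq> 0 \<or> u a \<noteq> 0"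
  shows "(L2w_norm {a..T} w y)\<^sup>2 > 0"
proof (rule ccontr)
  have int: "integrable (lebesgue_on {a..T}) (\<lambda>x. (cmod (y x))\<^sup>2 * w x)"
    using continuous_L2w[OF sl_expr_continuous(1)[OF y]] by (simp add: L2w_def)
  have nonneg: "AE x in lebesgue_on {a..T}. 0 \<le> (cmod (y x))\<^sup>2 * w x"
    using w_pos by eventually_elim simp
  assume "\<not> (L2w_norm {a..T} w y)\<^sup>2 > 0"
  then have "(\<integral>x. (cmod (y x))\<^sup>2 * w x \<partial>lebesgue_on {a..T}) = 0"
    using L2w_norm_power2[OF w_pos, of y] by (metis zero_less_power2 power_zero_numeral)
  then have "AE x in lebesgue_on {a..T}. (cmod (y x))\<^sup>2 * w x = 0"
    using integral_nonneg_eq_0_iff_AE[OF int nonneg] by simp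
  then have "AE x in lebesgue_on {a..T}. y x = 0"
    using w_pos by eventually_elim auto
  then show False
    using sl_expr_AE_zero_imp_zero[OF y, of a] nz aT by auto
qed

end

section \<open>Eigenvalues and Weyl solutions\<close>

lemma op_eigenvalue_in_spectrum:
  assumes "op_eigenvalue I T lam"
  shows "lam \<in> op_spectrum I w T"
proof -
  obtain y where y: "T y (\<lambda>x. lam * y x)" "\<not> (AE x in lebesgue_on I. y x = 0)"
    using assms unfolding op_eigenvalue_def by blast
  have "lam \<notin> op_resolvent_set I w T"
  proof
    assume "lam \<in> op_resolvent_set I w T"
    then have "\<forall>y g. T y g \<and> (AE x in lebesgue_on I. g x - lam * y x = 0) \<longrightarrow> (AE x in lebesgue_on I. y x = 0)"
      unfolding op_resolvent_set_def by simp
    from this[rule_format, OF conjI[OF y(1)]] show False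
      using y(2) by simp
  qed
  then show ?thesis by (simp add: op_spectrum_def)
qed

context sl_fundamental
begin

lemma sin_cos_nonzero: "sin \<alpha> \<noteq> 0 \<or> cos \<alpha> \<noteq> 0"
proof (rule ccontr)
  assume "\<not> (sin \<alpha> \<noteq> 0 \<or> cos \<alpha> \<noteq> 0)"
  then have "cos \<alpha> * cos \<alpha> + sin \<alpha> * sin \<alpha> = 0" by simp
  then show False unfolding sin_cos_squared_add3 by simp
qed

text \<open>The left boundary condition says that the Wronskian of the eigenfunction with
  \<open>\<phi> lam\<close> vanishes, so the eigenfunction is a nonzero multiple of
  \<open>\<phi> lam\<close>, which must then satisfy the condition at \<open>T\<close>.\<close>

lemma eigenvalue_characteristic:
  assumes "op_eigenvalue {a..T} (sl_operator {a..T} p q w (bc_M a \<alpha>) (bc_trunc T \<beta>)) lam"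
  shows "\<phi> lam T * cos \<beta> + \<phi>1 lam T * sin \<beta> = 0"
proof -
  obtain y u where y: "sl_solution {a..T} p q w lam y u" and bca: "cos \<alpha> * y a + sin \<alpha> * u a = 0"
    and bcb: "y T * cos \<beta> + u T * sin \<beta> = 0" and nz: "\<not> (AE x in lebesgue_on {a..T}. y x = 0)"
    using assms unfolding op_eigenvalue_def sl_operator_def bc_M_def bc_trunc_def sl_solution_def by blast
  \<comment> \<open>The factor of proportionality is the Wronskian with \<open>\<theta> lam\<close>,
    which is constant in \<open>x\<close>.\<close>
  define k where "k = y a * \<theta>1 lam a - u a * \<theta> lam a"
  have yk: "y x = k * \<phi> lam x" and uk: "u x = k * \<phi>1 lam x" if x: "x \<in> {a..T}" for x
  proof -
    have W1: "y x * \<theta>1 lam x - u x * \<theta> lam x = k"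
      using wronskian_identity[OF y theta x] by (simp add: k_def)
    have "y x * \<phi>1 lam x - u x * \<phi> lam x = - (cos \<alpha> * y a + sin \<alpha> * u a)"
      using wronskian_identity[OF y phi x] by (simp add: phi_a)
    then have W2: "y x * \<phi>1 lam x - u x * \<phi> lam x = 0" using bca by simp
    note W = wronskian_fundamental[OF x, of lam]
    have "y x = - (y x * (\<theta> lam x * \<phi>1 lam x - \<theta>1 lam x * \<phi> lam x))"
      unfolding W by simp
    also have "\<dots> = \<phi> lam x * (y x * \<theta>1 lam x - u x * \<theta> lam x)
        - \<theta> lam x * (y x * \<phi>1 lam x - u x * \<phi> lam x)"
      by (simp add: algebra_simps)
    finally show "y x = k * \<phi> lam x" unfolding W1 W2 by simp
    have "u x = - (u x * (\<theta> lam x * \<phi>1 lam x - \<theta>1 lam x * \<phi> lam x))"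
      unfolding W by simp
    also have "\<dots> = \<phi>1 lam x * (y x * \<theta>1 lam x - u x * \<theta> lam x)
        - \<theta>1 lam x * (y x * \<phi>1 lam x - u x * \<phi> lam x)"
      by (simp add: algebra_simps)
    finally show "u x = k * \<phi>1 lam x" unfolding W1 W2 by simp
  qed
  have "k \<noteq> 0"
  proof
    assume "k = 0"
    then have "y x = 0" if "x \<in> {a..T}" for x using yk[OF that] by simp
    then have "AE x in lebesgue_on {a..T}. y x = 0"
      by (intro AE_I2) simp
    then show False using nz by simp
  qed
  moreover have "k * (\<phi> lam T * cos \<beta> + \<phi>1 lam T * sin \<beta>) = 0"
    using bcb yk[of T] uk[of T] aT by (simp add: algebra_simps)
  ultimately show ?thesis by simp
qed

text \<open>The solution \<open>\<theta> lam\<close> satisfies the left condition of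
  \<open>L\<close> for every \<open>lam\<close>, so it is the eigenfunction as soon as the condition
  at \<open>T\<close> holds.\<close>

lemma characteristic_eigenvalue:
  assumes "\<theta> lam T * cos \<beta> + \<theta>1 lam T * sin \<beta> = 0"
  shows "op_eigenvalue {a..T} (sl_operator {a..T} p q w (bc_L a \<alpha>) (bc_trunc T \<beta>)) lam"
  unfolding op_eigenvalue_def
proof (intro exI conjI)
  note th = theta[of lam, unfolded sl_solution_def]
  show "sl_operator {a..T} p q w (bc_L a \<alpha>) (bc_trunc T \<beta>) (\<theta> lam) (\<lambda>x. lam * \<theta> lam x)"
    unfolding sl_operator_def
    using th continuous_L2w[OF fundamental_continuous(1), of lam] assms
    by (auto intro!: L2w_cmult exI[of _ "\<theta>1 lam"] simp: bc_L_def bc_trunc_def theta_a)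
  show "\<not> (AE x in lebesgue_on {a..T}. \<theta> lam x = 0)"
    using sl_expr_AE_zero_imp_zero[OF th, of a] sin_cos_nonzero aT by (auto simp: theta_a)
qed

text \<open>On the fixed compact interval \<open>m lam * \<phi> lam\<close> is the Weyl solution
  minus \<open>\<theta> lam\<close>. Near \<mu> the norms of both terms are bounded above, and the
  norm of \<open>\<phi> lam\<close> is bounded away from zero by continuity in
  \<open>lam\<close>.\<close>

lemma coefficient_bounded_if_norm_bounded:
  assumes I: "{a..T} \<subseteq> I" "I \<in> sets lebesgue" and w: "AE x in lebesgue_on I. 0 < w x"
    and psi: "\<And>lam. lam \<in> X \<Longrightarrow> (\<lambda>x. \<theta> lam x + m lam * \<phi> lam x) \<in> L2w I w"
    and bound: "\<And>lam. lam \<in> X \<Longrightarrow> (L2w_norm I w (\<lambda>x. \<theta> lam x + m lam * \<phi> lam x))\<^sup>2 \<le> B"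
  shows "\<exists>C. \<forall>\<^sub>F lam in nhds \<mu>. lam \<in> X \<longrightarrow> cmod (m lam) \<le> C"
proof -
  let ?n = "\<lambda>f. (L2w_norm {a..T} w f)\<^sup>2"
  define V where "V = ?n (\<lambda>_. 1)"
  have V: "V \<ge> 0" by (simp add: V_def)
  define \<kappa> where "\<kappa> = ?n (\<phi> \<mu>)"
  have \<kappa>: "\<kappa> > 0"
    using L2w_norm_solution_pos[OF phi[unfolded sl_solution_def], of \<mu>] sin_cos_nonzero
    by (auto simp: \<kappa>_def phi_a)
  \<comment> \<open>Chosen so that
    \<open>\<kappa> \<le> 2 * (\<kappa> / 4) + 2 * ?n (\<phi> lam)\<close>, which leaves the lower
    bound \<open>\<kappa> / 4\<close> for the squared norm of \<open>\<phi> lam\<close>.\<close>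
  define e where "e = sqrt (\<kappa> / (4 * (V + 1)))"
  have e: "e > 0" "e\<^sup>2 * V \<le> \<kappa> / 4"
  proof -
    show "e > 0" using \<kappa> V by (simp add: e_def)
    have "e\<^sup>2 = \<kappa> / (4 * (V + 1))" using \<kappa> V by (simp add: e_def)
    then have "e\<^sup>2 * (V + 1) = \<kappa> / 4" using V by (simp add: field_simps)
    moreover have "e\<^sup>2 * V \<le> e\<^sup>2 * (V + 1)" by (rule mult_left_mono) auto
    ultimately show "e\<^sup>2 * V \<le> \<kappa> / 4" by linarith
  qed
  obtain Q where Q: "Q > 0" "\<And>t. t \<in> {a..T} \<Longrightarrow> norm (\<theta> \<mu> t) \<le> Q"
    using continuous_bound[OF fundamental_continuous(1)] by metis
  define C where "C = sqrt ((2 * B + 2 * ((Q + 1)\<^sup>2 * V)) / (\<kappa> / 4))"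
  have "\<forall>\<^sub>F lam in nhds \<mu>. \<forall>x\<in>{a..T}. norm (\<phi> lam x - \<phi> \<mu> x) \<le> e"
    by (rule solution_uniformly_continuous_in_parameter[OF phi phi_a e(1)])
  moreover have "\<forall>\<^sub>F lam in nhds \<mu>. \<forall>x\<in>{a..T}. norm (\<theta> lam x - \<theta> \<mu> x) \<le> 1"
    by (rule solution_uniformly_continuous_in_parameter[OF theta theta_a]) simp
  ultimately have "\<forall>\<^sub>F lam in nhds \<mu>. lam \<in> X \<longrightarrow> cmod (m lam) \<le> C"
  proof eventually_elim
    case (elim lam)
    show ?case
    proof
      assume X: "lam \<in> X"
      have th: "?n (\<theta> lam) \<le> (Q + 1)\<^sup>2 * V"
        unfolding V_def
      proof (rule L2w_norm_le_sup[OF fundamental_continuous(1)])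
        fix t assume t: "t \<in> {a..T}"
        show "norm (\<theta> lam t) \<le> Q + 1"
          using norm_triangle_sub[of "\<theta> lam t" "\<theta> \<mu> t"] Q(2)[OF t] elim(2) t by fastforce
      qed
      have "?n (\<lambda>x. \<phi> \<mu> x - \<phi> lam x) \<le> e\<^sup>2 * V"
        unfolding V_def using elim(1)
        by (intro L2w_norm_le_sup continuous_intros fundamental_continuous) (auto simp: norm_minus_commute)
      moreover have "\<kappa> \<le> 2 * ?n (\<lambda>x. \<phi> \<mu> x - \<phi> lam x) + 2 * ?n (\<phi> lam)"
        using L2w_add(2)[OF w_pos, of "\<lambda>x. \<phi> \<mu> x - \<phi> lam x" "\<phi> lam"]
        by (simp add: \<kappa>_def continuous_L2w fundamental_continuous continuous_on_diff)
      ultimately have ph: "\<kappa> / 4 \<le> ?n (\<phi> lam)" using e(2) by linarith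
      let ?\<psi> = "\<lambda>x. \<theta> lam x + m lam * \<phi> lam x"
      have psiJ: "?\<psi> \<in> L2w {a..T} w" "?n ?\<psi> \<le> B"
        using L2w_subset[OF w psi[OF X] I] bound[OF X] by auto
      have "(cmod (m lam))\<^sup>2 * ?n (\<phi> lam) = ?n (\<lambda>x. ?\<psi> x + (-1) * \<theta> lam x)"
        by (simp add: L2w_norm_cmult[OF w_pos, symmetric])
      also have "\<dots> \<le> 2 * ?n ?\<psi> + 2 * ?n (\<lambda>x. (-1) * \<theta> lam x)"
        by (intro L2w_add w_pos psiJ L2w_cmult continuous_L2w fundamental_continuous)
      also have "\<dots> \<le> 2 * B + 2 * ((Q + 1)\<^sup>2 * V)"
        unfolding L2w_norm_cmult[OF w_pos] using psiJ(2) th by simp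
      finally have "(cmod (m lam))\<^sup>2 * ?n (\<phi> lam) \<le> 2 * B + 2 * ((Q + 1)\<^sup>2 * V)" .
      moreover have "(cmod (m lam))\<^sup>2 * (\<kappa> / 4) \<le> (cmod (m lam))\<^sup>2 * ?n (\<phi> lam)"
        by (rule mult_left_mono[OF ph]) simp
      ultimately have "(cmod (m lam))\<^sup>2 * (\<kappa> / 4) \<le> 2 * B + 2 * ((Q + 1)\<^sup>2 * V)"
        by linarith
      then have "(cmod (m lam))\<^sup>2 \<le> (2 * B + 2 * ((Q + 1)\<^sup>2 * V)) / (\<kappa> / 4)"
        using \<kappa> by (subst pos_le_divide_eq) auto
      then show "cmod (m lam) \<le> C"
        unfolding C_def by (rule real_le_rsqrt)
    qed
  qed
  then show ?thesis by blast
qed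

end

text \<open>The difference of two Weyl solutions lies in the domain of the operator, so the bounded inverse
  at \<open>\<mu>\<close> controls it.\<close>

lemma resolvent_bound_difference:
  assumes w: "AE x in lebesgue_on I. 0 < w x"
    and inv: "\<And>y g. T y g \<Longrightarrow> L2w_norm I w y \<le> C * L2w_norm I w (\<lambda>x. g x - \<mu> * y x)"
    and f: "f \<in> L2w I w" and f0: "f0 \<in> L2w I w"
    and T: "T (\<lambda>x. f x - f0 x) (\<lambda>x. lam * f x - lam0 * f0 x)"
    and small: "2 * \<bar>C\<bar> * cmod (lam - \<mu>) \<le> 1"
  shows "(L2w_norm I w f)\<^sup>2 \<le> (8 * C\<^sup>2 * (cmod (lam - lam0))\<^sup>2 + 2) * (L2w_norm I w f0)\<^sup>2"
proof -
  let ?n = "\<lambda>f. (L2w_norm I w f)\<^sup>2"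
  let ?y = "\<lambda>x. f x - f0 x"
  have y: "?y \<in> L2w I w"
    using L2w_add(1)[OF w f L2w_cmult[OF f0, of "-1"]] by simp
  \<comment> \<open>In HOL \<open>sqrt\<close> is negative on negative arguments, so the sign comes
    from \<open>w > 0\<close> a.e.; it is required for squaring the next inequality.\<close>
  have nonneg: "0 \<le> L2w_norm I w g" for g
  proof -
    have "0 \<le> (\<integral>x. (cmod (g x))\<^sup>2 * w x \<partial>lebesgue_on I)"
      by (rule integral_nonneg_AE) (use w in \<open>eventually_elim, simp\<close>)
    then show ?thesis by (simp add: L2w_norm_def)
  qed
  \<comment> \<open>This splitting puts the small factor \<open>lam - \<mu>\<close> on the unknown
    difference \<open>f - f0\<close>, where it can be absorbed, and leaves a multiple of the fixed
    \<open>f0\<close>.\<close>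
  have eq: "(\<lambda>x. (lam * f x - lam0 * f0 x) - \<mu> * (f x - f0 x)) =
      (\<lambda>x. (lam - \<mu>) * (f x - f0 x) + (lam - lam0) * f0 x)"
    by (simp add: algebra_simps)
  have "L2w_norm I w ?y \<le> C * L2w_norm I w (\<lambda>x. (lam - \<mu>) * (f x - f0 x) + (lam - lam0) * f0 x)"
    using inv[OF T] unfolding eq .
  then have "?n ?y \<le> (C * L2w_norm I w (\<lambda>x. (lam - \<mu>) * (f x - f0 x) + (lam - lam0) * f0 x))\<^sup>2"
    by (intro power_mono nonneg)
  also have "\<dots> = C\<^sup>2 * ?n (\<lambda>x. (lam - \<mu>) * (f x - f0 x) + (lam - lam0) * f0 x)"
    by (simp add: power_mult_distrib)
  also have "\<dots> \<le> C\<^sup>2 * (2 * ?n (\<lambda>x. (lam - \<mu>) * (f x - f0 x)) + 2 * ?n (\<lambda>x. (lam - lam0) * f0 x))"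
    by (intro mult_left_mono L2w_add w L2w_cmult y f0) simp
  also have "\<dots> = (2 * \<bar>C\<bar> * cmod (lam - \<mu>))\<^sup>2 / 2 * ?n ?y + 2 * C\<^sup>2 * (cmod (lam - lam0))\<^sup>2 * ?n f0"
    unfolding L2w_norm_cmult[OF w] by (simp add: power_mult_distrib algebra_simps)
  \<comment> \<open>The assumption \<open>small\<close> is exactly what lets half of
    \<open>?n ?y\<close> move to the left-hand side.\<close>
  also have "\<dots> \<le> 1 / 2 * ?n ?y + 2 * C\<^sup>2 * (cmod (lam - lam0))\<^sup>2 * ?n f0"
  proof -
    have "(2 * \<bar>C\<bar> * cmod (lam - \<mu>))\<^sup>2 \<le> 1"
      using power_mono[OF small, of 2] by simp
    then show ?thesis by (intro add_right_mono mult_right_mono) auto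
  qed
  finally have "?n ?y \<le> 4 * C\<^sup>2 * (cmod (lam - lam0))\<^sup>2 * ?n f0" by simp
  moreover have "?n f \<le> 2 * ?n ?y + 2 * ?n f0"
    using L2w_add(2)[OF w y f0] by simp
  ultimately show ?thesis by (simp add: algebra_simps)
qed

section \<open>Zeros and poles of converging meromorphic functions\<close>

text \<open>The quantitative core: the radius \<delta> must not depend on \<open>n\<close>. It is
  found from a common bound for the quotients \<open>D n / N n\<close> on one circle and from the
  bound \<open>B\<close> for \<open>m\<close>, by way of Cauchy's estimate for the
  derivative.\<close>

lemma zeros_accompany_poles:
  fixes N D :: "nat \<Rightarrow> complex \<Rightarrow> complex" and m l :: "complex \<Rightarrow> complex" and \<mu> :: complex
  defines "A \<equiv> \<lambda>r s. cball \<mu> s - ball \<mu> r"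
  assumes N: "\<And>n. N n holomorphic_on UNIV" and D: "\<And>n. D n holomorphic_on UNIV"
    and R: "R > 0"
    and nz: "\<And>r s. 0 < r \<Longrightarrow> r < s \<Longrightarrow> s < R \<Longrightarrow>
      \<forall>\<^sub>F n in sequentially. \<forall>z\<in>A r s. N n z \<noteq> 0 \<and> D n z \<noteq> 0"
    and m: "\<And>r s. 0 < r \<Longrightarrow> r < s \<Longrightarrow> s < R \<Longrightarrow>
      uniform_limit (A r s) (\<lambda>n z. - N n z / D n z) m sequentially"
    and l: "\<And>r s. 0 < r \<Longrightarrow> r < s \<Longrightarrow> s < R \<Longrightarrow>
      uniform_limit (A r s) (\<lambda>n z. D n z / N n z) l sequentially"
    and B: "\<And>z. z \<in> ball \<mu> R - {\<mu>} \<Longrightarrow> cmod (m z) \<le> B"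
    and eps: "\<epsilon> > 0"
  shows "\<exists>\<delta>>0. \<forall>\<^sub>F n in sequentially. (\<exists>z\<in>ball \<mu> \<delta>. D n z = 0) \<longrightarrow> (\<exists>z\<in>ball \<mu> \<epsilon>. N n z = 0)"
proof -
  define r where "r = min \<epsilon> R / 2"
  have r: "0 < r" "r < \<epsilon>" "r < R" using eps R by (auto simp: r_def)
  have B0: "B \<ge> 0"
    by (rule order_trans[OF norm_ge_zero B[of "\<mu> + of_real r"]]) (use r in \<open>auto simp: dist_norm\<close>)
  have "\<forall>\<^sub>F n in sequentially. \<forall>z\<in>A (r/2) r. dist (D n z / N n z) (l z) < 1"
    using uniform_limitD[OF l[of "r/2" r], of 1] r by auto
  moreover have "\<forall>\<^sub>F n in sequentially. \<forall>z\<in>A (r/2) r. N n z \<noteq> 0 \<and> D n z \<noteq> 0"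
    by (rule nz) (use r in auto)
  ultimately have ev1: "\<forall>\<^sub>F n in sequentially.
      (\<forall>z\<in>A (r/2) r. dist (D n z / N n z) (l z) < 1) \<and> (\<forall>z\<in>A (r/2) r. N n z \<noteq> 0)"
    by eventually_elim auto
  \<comment> \<open>One admissible index suffices to bound all later quotients: at every point of
    the annulus they and the one at \<open>n1\<close> are within distance 1 of the same value of
    \<open>l\<close>.\<close>
  then obtain n1 where n1: "\<forall>z\<in>A (r/2) r. dist (D n1 z / N n1 z) (l z) < 1" "\<forall>z\<in>A (r/2) r. N n1 z \<noteq> 0"
    unfolding eventually_sequentially by blast
  have "compact (A (r/2) r)"
    unfolding A_def by (rule compact_diff) auto
  moreover have "continuous_on (A (r/2) r) (\<lambda>z. D n1 z / N n1 z)"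
    using n1(2) N[of n1] D[of n1]
    by (intro continuous_on_divide) (auto intro: holomorphic_on_imp_continuous_on holomorphic_on_subset)
  ultimately have "bounded ((\<lambda>z. D n1 z / N n1 z) ` A (r/2) r)"
    by (intro compact_imp_bounded compact_continuous_image)
  then obtain C0 where C0: "C0 > 0" "\<And>z. z \<in> A (r/2) r \<Longrightarrow> norm (D n1 z / N n1 z) \<le> C0"
    unfolding bounded_pos by blast
  \<comment> \<open>The summand 2 is twice the distance 1 to \<open>l\<close>.\<close>
  define C where "C = C0 + 2"
  have C: "C > 0" using C0 by (simp add: C_def)
  \<comment> \<open>With derivative at most \<open>2 * C / r\<close> and points at distance at most
    \<open>2 * s\<close>, the second entry makes the quotient at most
    \<open>1 / (2 * (B + 1))\<close>; the first keeps all points inside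
    \<open>cball \<mu> (r/2)\<close>.\<close>
  define s where "s = min (r/4) (r / (8 * C * (B + 1)))"
  have s: "0 < s" "s \<le> r/4" "s \<le> r / (8 * C * (B + 1))" "s < R"
    using r C B0 by (auto simp: s_def)
  have "\<forall>\<^sub>F n in sequentially. \<forall>z\<in>A (s/2) s. dist (- N n z / D n z) (m z) < 1"
    using uniform_limitD[OF m[of "s/2" s], of 1] s by auto
  moreover have "\<forall>\<^sub>F n in sequentially. \<forall>z\<in>A (s/2) s. N n z \<noteq> 0 \<and> D n z \<noteq> 0"
    by (rule nz) (use s in auto)
  ultimately have "\<forall>\<^sub>F n in sequentially. (\<exists>z\<in>ball \<mu> s. D n z = 0) \<longrightarrow> (\<exists>z\<in>ball \<mu> \<epsilon>. N n z = 0)"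
    using ev1
  proof eventually_elim
    case (elim n)
    show ?case
    proof (intro impI, rule ccontr)
      assume "\<exists>z\<in>ball \<mu> s. D n z = 0" and no: "\<not> (\<exists>z\<in>ball \<mu> \<epsilon>. N n z = 0)"
      then obtain z0 where z0: "z0 \<in> ball \<mu> s" "D n z0 = 0" by blast
      define g where "g = (\<lambda>z. D n z / N n z)"
      have hol: "g holomorphic_on ball \<mu> \<epsilon>"
        unfolding g_def using no N D by (intro holomorphic_on_divide) (auto intro: holomorphic_on_subset)
      have sub: "cball \<mu> r \<subseteq> ball \<mu> \<epsilon>" using r by auto
      have circ: "norm (g z) \<le> C" if "z \<in> sphere \<mu> r" for z
      proof -
        have z: "z \<in> A (r/2) r" using that r by (auto simp: A_def)
        have "norm (g z) \<le> norm (D n1 z / N n1 z) + dist (g z) (l z) + dist (D n1 z / N n1 z) (l z)"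
          using norm_triangle_ineq4[of "g z - l z" "D n1 z / N n1 z - l z"]
            norm_triangle_ineq[of "D n1 z / N n1 z" "(g z - l z) - (D n1 z / N n1 z - l z)"]
          by (simp add: dist_norm)
        also have "\<dots> \<le> C0 + 1 + 1"
          using C0(2)[OF z] n1(1) elim(3) z unfolding g_def by (intro add_mono less_imp_le) auto
        finally show ?thesis by (simp add: C_def)
      qed
      have bd: "norm (g z) \<le> C" if "z \<in> cball \<mu> r" for z
      proof (rule maximum_modulus_frontier[of g "cball \<mu> r"])
        show "g holomorphic_on interior (cball \<mu> r)"
          by (rule holomorphic_on_subset[OF hol]) (use sub interior_subset in blast)
        show "continuous_on (closure (cball \<mu> r)) g"
          using holomorphic_on_imp_continuous_on[OF holomorphic_on_subset[OF hol sub]] by simp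
      qed (use that circ in auto)
      \<comment> \<open>Around each point of the half disc there is still a disc of radius
        \<open>r/2\<close> on which \<open>\<bar>g\<bar> \<le> C\<close>, so Cauchy's inequality
        applies there.\<close>
      have deriv: "norm (deriv g z) \<le> 2 * C / r" if z: "z \<in> cball \<mu> (r/2)" for z
      proof -
        have subz: "cball z (r/2) \<subseteq> cball \<mu> r"
        proof
          fix x assume "x \<in> cball z (r/2)"
          then show "x \<in> cball \<mu> r"
            using z dist_triangle[of \<mu> x z] by auto
        qed
        have "norm ((deriv ^^ 1) g z) \<le> fact 1 * C / (r/2) ^ 1"
        proof (rule Cauchy_inequality)
          show "g holomorphic_on ball z (r/2)"
            by (rule holomorphic_on_subset[OF hol]) (use subz sub ball_subset_cball in blast)
          show "continuous_on (cball z (r/2)) g"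
            using holomorphic_on_imp_continuous_on[OF holomorphic_on_subset[OF hol]] subz sub by blast
          show "norm (g x) \<le> C" if "norm (z - x) = r/2" for x
            using bd subz that by (auto simp: dist_norm subset_iff)
        qed (use r in auto)
        then show ?thesis by (simp add: field_simps)
      qed
      \<comment> \<open>A point on the circle of radius \<open>s\<close>: it lies in the annulus
        where \<open>m\<close> is approximated, yet close to the zero \<open>z0\<close> of
        \<open>g\<close>.\<close>
      let ?z = "\<mu> + of_real s"
      have zA: "?z \<in> A (s/2) s" "?z \<in> ball \<mu> R - {\<mu>}"
        using s by (auto simp: A_def dist_norm)
      have "norm (g ?z - g z0) \<le> 2 * C / r * norm (?z - z0)"
      proof (rule field_differentiable_bound[of "cball \<mu> (r/2)" g "deriv g"])
        show "(g has_field_derivative deriv g z) (at z within cball \<mu> (r/2))" if "z \<in> cball \<mu> (r/2)" for z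
          using that r by (intro holomorphic_derivI[OF hol]) auto
      qed (use deriv s z0 r in \<open>auto simp: dist_norm\<close>)
      also have "\<dots> \<le> 2 * C / r * (2 * s)"
      proof (rule mult_left_mono)
        show "norm (?z - z0) \<le> 2 * s"
          using norm_triangle_ineq[of "of_real s" "\<mu> - z0"] z0(1) s by (auto simp: dist_norm algebra_simps)
      qed (use C r in auto)
      also have "\<dots> \<le> 2 * C / r * (2 * (r / (8 * C * (B + 1))))"
        using s(3) C r by (intro mult_left_mono) auto
      also have "\<dots> = 1 / (2 * (B + 1))"
      proof -
        have "2 * C / r * (2 * (r / (8 * C * b))) = 1 / (2 * b)" if "b > 0" for b
          using C r that by (simp add: field_simps)
        moreover have "B + 1 > 0" using B0 by simp
        ultimately show ?thesis by blast
      qed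
      finally have small: "norm (g ?z) \<le> 1 / (2 * (B + 1))"
        using z0(2) by (simp add: g_def)
      have nzz: "N n ?z \<noteq> 0" "D n ?z \<noteq> 0" using elim(2) zA by auto
      \<comment> \<open>The reciprocal quotients have moduli below \<open>B + 1\<close> and at most
        \<open>1 / (2 * (B + 1))\<close>, but their product is 1.\<close>
      have "norm (- N n ?z / D n ?z) \<le> norm (m ?z) + dist (- N n ?z / D n ?z) (m ?z)"
        unfolding dist_norm by (rule norm_triangle_sub)
      also have "\<dots> < B + 1"
        using B[OF zA(2)] elim(1) zA(1) by (intro add_le_less_mono) auto
      finally have "norm (N n ?z / D n ?z) < B + 1" by (simp add: norm_divide)
      moreover have "norm (N n ?z / D n ?z) * norm (g ?z) = 1"
        using nzz by (simp add: g_def norm_divide)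
      moreover have "norm (N n ?z / D n ?z) * norm (g ?z) \<le> (B + 1) * (1 / (2 * (B + 1)))"
        using calculation(1) small B0 by (intro mult_mono) auto
      ultimately show False using B0 by simp
    qed
  qed
  then show ?thesis using s(1) by blast
qed

section \<open>Eigenvalues of the truncated operators\<close>

lemma ico_lebesgue: "ico a b \<in> sets lebesgue"
proof -
  have "ico a b = {a..} \<inter> {x. ereal x < b}" by (auto simp: ico_def)
  moreover have "{x. ereal x < b} \<in> sets borel" by measurable
  ultimately have "ico a b \<in> sets borel" by auto
  then show ?thesis by (simp add: sets_completionI_sets)
qed

lemma Icc_subset_ico: "ereal t < b \<Longrightarrow> {a..t} \<subseteq> ico a b"
  by (auto simp: ico_def intro: le_less_trans[of _ "ereal t"])

lemma bc_right_diff: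
  assumes "bc_right c b \<psi> \<psi>1 y u" "bc_right c b \<psi> \<psi>1 z v"
  shows "bc_right c b \<psi> \<psi>1 (\<lambda>x. y x - z x) (\<lambda>x. u x - v x)"
  unfolding bc_right_def
proof
  assume c: "c \<noteq> Case_I"
  show "((\<lambda>x. (y (real_of_ereal x) - z (real_of_ereal x)) * \<psi>1 (real_of_ereal x) -
      (u (real_of_ereal x) - v (real_of_ereal x)) * \<psi> (real_of_ereal x)) \<longlongrightarrow> 0) (at_left b)"
    using tendsto_diff[OF assms[unfolded bc_right_def, THEN mp[OF _ c]]]
    by (simp add: algebra_simps)
qed

lemma trunc_weyl_value_iff:
  "trunc_weyl_value d \<beta> \<theta> \<theta>1 \<phi> \<phi>1 z \<longleftrightarrow>
    (\<theta> d * cos \<beta> + \<theta>1 d * sin \<beta>) + z * (\<phi> d * cos \<beta> + \<phi>1 d * sin \<beta>) = 0"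
  unfolding trunc_weyl_value_def bc_trunc_def by (simp add: algebra_simps)

text \<open>With \<open>B = 0\<close> either no \<open>z\<close> or every \<open>z\<close> is a
  root. Thus unique existence of a value of a truncated Weyl function encodes that its denominator
  does not vanish.\<close>

lemma unique_root_linear:
  fixes A B :: complex
  assumes "\<exists>!z. A + z * B = 0"
  shows "B \<noteq> 0" "(THE z. A + z * B = 0) = - A / B"
proof -
  show B: "B \<noteq> 0"
  proof
    assume "B = 0"
    then show False using assms by (metis mult_zero_right zero_neq_one)
  qed
  have "A + (- A / B) * B = 0" using B by simp
  then show "(THE z. A + z * B = 0) = - A / B"
    by (rule the1_equality[OF assms])
qed

text \<open>The compact annuli exhaust the punctured disc, so pointwise facts pass from the former
  to the latter.\<close>

lemma punctured_ball_in_annulus: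
  assumes "z \<in> ball \<mu> R - {\<mu>}"
  obtains r s where "0 < r" "r < s" "s < R" "z \<in> cball \<mu> s - ball \<mu> r"
proof
  show "0 < dist \<mu> z / 2" "dist \<mu> z / 2 < (dist \<mu> z + R) / 2" "(dist \<mu> z + R) / 2 < R"
    "z \<in> cball \<mu> ((dist \<mu> z + R) / 2) - ball \<mu> (dist \<mu> z / 2)"
    using assms order_le_less_trans[OF zero_le_dist[of \<mu> z], of R] by (auto simp: field_simps)
qed

lemma converges_on_annuliE:
  assumes "converges_on_annuli \<mu> P P0"
  obtains R where "R > 0"
    "\<And>z. z \<in> ball \<mu> R - {\<mu>} \<Longrightarrow> \<exists>!v. P0 z v"
    "\<And>r s. 0 < r \<Longrightarrow> r < s \<Longrightarrow> s < R \<Longrightarrow>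
      \<forall>\<^sub>F n in sequentially. \<forall>z\<in>cball \<mu> s - ball \<mu> r. \<exists>!v. P n z v"
    "\<And>r s. 0 < r \<Longrightarrow> r < s \<Longrightarrow> s < R \<Longrightarrow>
      uniform_limit (cball \<mu> s - ball \<mu> r) (\<lambda>n z. THE v. P n z v) (\<lambda>z. THE v. P0 z v) sequentially"
proof -
  from assms[unfolded converges_on_annuli_def Let_def]
  obtain R where R: "R > 0" and ann: "\<forall>r s. 0 < r \<and> r < s \<and> s < R \<longrightarrow>
      (\<forall>z\<in>cball \<mu> s - ball \<mu> r. \<exists>!v. P0 z v) \<and>
      (\<forall>\<^sub>F n in sequentially. \<forall>z\<in>cball \<mu> s - ball \<mu> r. \<exists>!v. P n z v) \<and>
      uniform_limit (cball \<mu> s - ball \<mu> r) (\<lambda>n z. THE v. P n z v) (\<lambda>z. THE v. P0 z v) sequentially"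
    by (elim exE conjE) (rule that)
  show ?thesis
  proof (rule that[OF R])
    fix z assume "z \<in> ball \<mu> R - {\<mu>}"
    then obtain r s where "0 < r" "r < s" "s < R" "z \<in> cball \<mu> s - ball \<mu> r"
      by (rule punctured_ball_in_annulus)
    then show "\<exists>!v. P0 z v" using ann[THEN spec[of _ r], THEN spec[of _ s]] by blast
  next
    fix r s :: real assume rs: "0 < r" "r < s" "s < R"
    show "\<forall>\<^sub>F n in sequentially. \<forall>z\<in>cball \<mu> s - ball \<mu> r. \<exists>!v. P n z v"
      using ann[THEN spec, THEN spec, THEN mp, OF conjI[OF rs(1) conjI[OF rs(2,3)]]] by (elim conjE)
    show "uniform_limit (cball \<mu> s - ball \<mu> r) (\<lambda>n z. THE v. P n z v) (\<lambda>z. THE v. P0 z v) sequentially"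
      using ann[THEN spec, THEN spec, THEN mp, OF conjI[OF rs(1) conjI[OF rs(2,3)]]] by (elim conjE)
  qed
qed

theorem theorem3p1:
  fixes a :: real and b :: ereal
    and p q :: "real \<Rightarrow> complex" and w :: "real \<Rightarrow> real"
    and \<alpha> K lam' m' \<mu> :: complex and \<eta> :: real and c :: sims_case
    and \<theta> \<theta>1 \<phi> \<phi>1 :: "complex \<Rightarrow> real \<Rightarrow> complex"
    and d :: "nat \<Rightarrow> real" and \<beta> :: "nat \<Rightarrow> complex"
  defines "I \<equiv> ico a b"
    and "I\<^sub>n \<equiv> \<lambda>n. {a..d n}"
    and "bc\<^sub>b \<equiv> bc_right c b (\<lambda>x. \<theta> lam' x + m' * \<phi> lam' x) (\<lambda>x. \<theta>1 lam' x + m' * \<phi>1 lam' x)"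
  defines "M \<equiv> sl_operator I p q w (bc_M a \<alpha>) bc\<^sub>b"
    and "M\<^sub>n \<equiv> \<lambda>n. sl_operator (I\<^sub>n n) p q w (bc_M a \<alpha>) (bc_trunc (d n) (\<beta> n))"
    and "L\<^sub>n \<equiv> \<lambda>n. sl_operator (I\<^sub>n n) p q w (bc_L a \<alpha>) (bc_trunc (d n) (\<beta> n))"
    and "m \<equiv> \<lambda>lam. weyl_value I w bc\<^sub>b (\<theta> lam) (\<theta>1 lam) (\<phi> lam) (\<phi>1 lam)"
    and "l \<equiv> \<lambda>lam. weyl_value I w bc\<^sub>b (\<phi> lam) (\<phi>1 lam) (\<lambda>x. - \<theta> lam x) (\<lambda>x. - \<theta>1 lam x)"
    and "m\<^sub>n \<equiv> \<lambda>n lam. trunc_weyl_value (d n) (\<beta> n) (\<theta> lam) (\<theta>1 lam) (\<phi> lam) (\<phi>1 lam)"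
    and "l\<^sub>n \<equiv> \<lambda>n lam. trunc_weyl_value (d n) (\<beta> n) (\<phi> lam) (\<phi>1 lam) (\<lambda>x. - \<theta> lam x) (\<lambda>x. - \<theta>1 lam x)"
  assumes "sl_coefficients a b p q w"
    and "singular_right_end a b p q w"
    and "sims_Q a b p q w \<noteq> UNIV"
    and "(\<eta>, K) \<in> sims_S\<alpha> a b p q w \<alpha>"
    and "\<And>lam. sl_solution I p q w lam (\<theta> lam) (\<theta>1 lam)"
    and "\<And>lam. \<theta> lam a = cos \<alpha>" and "\<And>lam. \<theta>1 lam a = sin \<alpha>"
    and "\<And>lam. sl_solution I p q w lam (\<phi> lam) (\<phi>1 lam)"
    and "\<And>lam. \<phi> lam a = sin \<alpha>" and "\<And>lam. \<phi>1 lam a = - cos \<alpha>"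
    and "in_sims_case c I p q w \<eta> K"
    and "lam' \<in> half_plane \<eta> K"
    and "\<And>n. a < d n" and "\<And>n. ereal (d n) < b"
    and "incseq d" and "(\<lambda>n. ereal (d n)) \<longlonglongrightarrow> b"
    and "\<mu> \<notin> op_spectrum I w M"
    and "converges_on_annuli \<mu> m\<^sub>n m"
    and "converges_on_annuli \<mu> l\<^sub>n l"
  shows
    "(\<exists>U N. open U \<and> \<mu> \<in> U \<and> (\<forall>n\<ge>N. \<forall>lam\<in>U. \<not> op_eigenvalue (I\<^sub>n n) (M\<^sub>n n) lam)) \<or>
     (\<exists>(k :: nat \<Rightarrow> nat) (lams :: nat \<Rightarrow> complex) (\<mu>s :: nat \<Rightarrow> complex).
        strict_mono k \<and> (\<forall>j. 0 < k j) \<and>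
        (\<forall>j. lams j \<in> op_spectrum (I\<^sub>n (k j)) w (M\<^sub>n (k j))) \<and>
        (\<forall>j. \<mu>s j \<in> op_spectrum (I\<^sub>n (k j)) w (L\<^sub>n (k j))) \<and>
        lams \<longlonglongrightarrow> \<mu> \<and> \<mu>s \<longlonglongrightarrow> \<mu>)"
proof -

  \<comment> \<open>The fundamental system on each truncated interval\<close>
  note coeff = assms(11) and theta = assms(15-17) and phi = assms(18-20)
  have dI: "{a..d n} \<subseteq> I" for n
    unfolding I_def using Icc_subset_ico assms(24) by blast
  have I_leb: "I \<in> sets lebesgue" by (simp add: I_def ico_lebesgue)
  have pw: "AE x in lebesgue_on I. 0 < w x \<and> p x \<noteq> 0"
    using coeff unfolding sl_coefficients_def I_def by (elim conjE)
  then have w_pos: "AE x in lebesgue_on I. 0 < w x"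
    by eventually_elim simp
  have fund: "sl_fundamental a (d n) p q w \<theta> \<theta>1 \<phi> \<phi>1 \<alpha>" for n
  proof unfold_locales
    show "a < d n" by fact
    show "AE x in lebesgue_on {a..d n}. 0 < w x \<and> p x \<noteq> 0"
      by (rule AE_lebesgue_on_subset[OF pw dI I_leb]) simp
    have "d n \<in> ico a b" using assms(23,24)[of n] by (simp add: ico_def)
    then show "w absolutely_integrable_on {a..d n}"
      using coeff by (simp add: sl_coefficients_def)
    show "sl_solution {a..d n} p q w lam (\<theta> lam) (\<theta>1 lam)" "sl_solution {a..d n} p q w lam (\<phi> lam) (\<phi>1 lam)" for lam
      using theta(1)[of lam] phi(1)[of lam] sl_expr_subset[OF _ dI[of n] I_leb]
      unfolding sl_solution_def I_def by auto
  qed (use theta phi in auto)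

  \<comment> \<open>Characteristic functions and truncated Weyl functions\<close>
  define N where "N = (\<lambda>n lam. \<theta> lam (d n) * cos (\<beta> n) + \<theta>1 lam (d n) * sin (\<beta> n))"
  define D where "D = (\<lambda>n lam. \<phi> lam (d n) * cos (\<beta> n) + \<phi>1 lam (d n) * sin (\<beta> n))"
  have N_hol: "N n holomorphic_on UNIV" and D_hol: "D n holomorphic_on UNIV" for n
    unfolding N_def D_def
    using sl_fundamental.theta_differentiable[OF fund] sl_fundamental.phi_differentiable[OF fund]
    by (intro holomorphic_intros; simp add: holomorphic_on_def field_differentiable_at_within)+
  have mn: "m\<^sub>n n lam z \<longleftrightarrow> N n lam + z * D n lam = 0" for n lam z
    by (simp add: m\<^sub>n_def trunc_weyl_value_iff N_def D_def)
  \<comment> \<open>For the pair \<open>(\<phi>, -\<theta>)\<close> the roles of \<open>N\<close>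
    and \<open>D\<close> are exchanged and \<open>N\<close> changes sign, so the root is
    \<open>D / N\<close>.\<close>
  have ln: "l\<^sub>n n lam z \<longleftrightarrow> D n lam + z * (- N n lam) = 0" for n lam z
    by (simp add: l\<^sub>n_def trunc_weyl_value_iff N_def D_def algebra_simps)
  obtain R1 where R1: "R1 > 0" "\<And>z. z \<in> ball \<mu> R1 - {\<mu>} \<Longrightarrow> \<exists>!v. m z v"
    "\<And>r s. 0 < r \<Longrightarrow> r < s \<Longrightarrow> s < R1 \<Longrightarrow>
      \<forall>\<^sub>F n in sequentially. \<forall>z\<in>cball \<mu> s - ball \<mu> r. \<exists>!v. m\<^sub>n n z v"
    "\<And>r s. 0 < r \<Longrightarrow> r < s \<Longrightarrow> s < R1 \<Longrightarrow>
      uniform_limit (cball \<mu> s - ball \<mu> r) (\<lambda>n z. THE v. m\<^sub>n n z v) (\<lambda>z. THE v. m z v) sequentially"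
    by (rule converges_on_annuliE[OF \<open>converges_on_annuli \<mu> m\<^sub>n m\<close>]) (rule that)
  obtain R2 where R2: "R2 > 0" "\<And>z. z \<in> ball \<mu> R2 - {\<mu>} \<Longrightarrow> \<exists>!v. l z v"
    "\<And>r s. 0 < r \<Longrightarrow> r < s \<Longrightarrow> s < R2 \<Longrightarrow>
      \<forall>\<^sub>F n in sequentially. \<forall>z\<in>cball \<mu> s - ball \<mu> r. \<exists>!v. l\<^sub>n n z v"
    "\<And>r s. 0 < r \<Longrightarrow> r < s \<Longrightarrow> s < R2 \<Longrightarrow>
      uniform_limit (cball \<mu> s - ball \<mu> r) (\<lambda>n z. THE v. l\<^sub>n n z v) (\<lambda>z. THE v. l z v) sequentially"
    by (rule converges_on_annuliE[OF \<open>converges_on_annuli \<mu> l\<^sub>n l\<close>]) (rule that)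

  \<comment> \<open>Weyl solutions near \<mu> and their norms\<close>
  define mf where "mf = (\<lambda>z. THE v. m z v)"
  define \<psi> where "\<psi> = (\<lambda>lam x. \<theta> lam x + mf lam * \<phi> lam x)"
  define \<psi>1 where "\<psi>1 = (\<lambda>lam x. \<theta>1 lam x + mf lam * \<phi>1 lam x)"
  define X where "X = ball \<mu> R1 - {\<mu>}"
  have weyl: "\<psi> lam \<in> L2w I w" "bc\<^sub>b (\<psi> lam) (\<psi>1 lam)" if "lam \<in> X" for lam
  proof -
    have "m lam (mf lam)"
      unfolding mf_def by (rule theI') (use R1(2) that in \<open>simp add: X_def\<close>)
    then show "\<psi> lam \<in> L2w I w" "bc\<^sub>b (\<psi> lam) (\<psi>1 lam)"
      unfolding m_def weyl_value_def \<psi>_def \<psi>1_def by auto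
  qed
  have expr: "sl_expr I p q w (\<psi> lam) (\<psi>1 lam) (\<lambda>x. lam * \<psi> lam x)" for lam
    using sl_expr_lincomb[OF theta(1)[of lam, unfolded sl_solution_def] phi(1)[of lam, unfolded sl_solution_def], of 1 "mf lam"]
    unfolding \<psi>_def \<psi>1_def by (simp add: algebra_simps)
  have diff: "M (\<lambda>x. \<psi> lam x - \<psi> lam0 x) (\<lambda>x. lam * \<psi> lam x - lam0 * \<psi> lam0 x)"
    if X: "lam \<in> X" "lam0 \<in> X" for lam lam0
    unfolding M_def sl_operator_def
  proof (intro conjI exI[of _ "\<lambda>x. \<psi>1 lam x - \<psi>1 lam0 x"])
    show "(\<lambda>x. \<psi> lam x - \<psi> lam0 x) \<in> L2w I w"
      using L2w_add(1)[OF w_pos weyl(1)[OF X(1)] L2w_cmult[OF weyl(1)[OF X(2)], of "-1"]] by simp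
    show "(\<lambda>x. lam * \<psi> lam x - lam0 * \<psi> lam0 x) \<in> L2w I w"
      using L2w_add(1)[OF w_pos L2w_cmult[OF weyl(1)[OF X(1)], of lam] L2w_cmult[OF weyl(1)[OF X(2)], of "-lam0"]] by simp
    show "sl_expr I p q w (\<lambda>x. \<psi> lam x - \<psi> lam0 x) (\<lambda>x. \<psi>1 lam x - \<psi>1 lam0 x)
        (\<lambda>x. lam * \<psi> lam x - lam0 * \<psi> lam0 x)"
      using sl_expr_lincomb[OF expr[of lam] expr[of lam0], of 1 "-1"] by simp
    \<comment> \<open>At \<open>a\<close> the functional
      \<open>cos \<alpha> * y + sin \<alpha> * u\<close> takes the value 1 on every Weyl solution,
      whatever the coefficient \<open>mf\<close>, so it vanishes on differences.\<close>
    show "bc_M a \<alpha> (\<lambda>x. \<psi> lam x - \<psi> lam0 x) (\<lambda>x. \<psi>1 lam x - \<psi>1 lam0 x)"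
      using theta phi by (simp add: bc_M_def \<psi>_def \<psi>1_def algebra_simps)
    show "bc\<^sub>b (\<lambda>x. \<psi> lam x - \<psi> lam0 x) (\<lambda>x. \<psi>1 lam x - \<psi>1 lam0 x)"
      unfolding bc\<^sub>b_def by (rule bc_right_diff) (use weyl(2) X in \<open>auto simp: bc\<^sub>b_def\<close>)
  qed
  obtain C where C: "\<And>y g. M y g \<Longrightarrow> L2w_norm I w y \<le> C * L2w_norm I w (\<lambda>x. g x - \<mu> * y x)"
    using \<open>\<mu> \<notin> op_spectrum I w M\<close> unfolding op_spectrum_def op_resolvent_set_def by auto
  \<comment> \<open>A fixed reference point, against which all Weyl solutions near \<mu> are
    compared.\<close>
  define lam0 where "lam0 = \<mu> + of_real (R1 / 2)"
  have lam0: "lam0 \<in> X" using R1(1) by (auto simp: lam0_def X_def dist_norm)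
  \<comment> \<open>This radius ensures
    \<open>2 * \<bar>C\<bar> * cmod (lam - \<mu>) \<le> 1\<close>; the \<open>+ 1\<close> covers
    \<open>C = 0\<close>, and \<open>\<bar>C\<bar>\<close> appears because the resolvent bound
    leaves the sign of \<open>C\<close> open.\<close>
  define \<rho> where "\<rho> = min R1 (1 / (2 * \<bar>C\<bar> + 1))"
  have \<rho>: "\<rho> > 0" "\<rho> \<le> R1" using R1(1) by (auto simp: \<rho>_def)
  define Y where "Y = ball \<mu> \<rho> - {\<mu>}"
  have YX: "Y \<subseteq> X" using \<rho> by (auto simp: Y_def X_def)
  have bound: "(L2w_norm I w (\<psi> lam))\<^sup>2 \<le> (8 * C\<^sup>2 * (2 * R1)\<^sup>2 + 2) * (L2w_norm I w (\<psi> lam0))\<^sup>2"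
    if Y: "lam \<in> Y" for lam
  proof -
    have lX: "lam \<in> X" using Y YX by blast
    have d: "cmod (lam - \<mu>) < 1 / (2 * \<bar>C\<bar> + 1)"
      using Y by (auto simp: Y_def \<rho>_def dist_norm norm_minus_commute)
    have "2 * \<bar>C\<bar> * cmod (lam - \<mu>) \<le> (2 * \<bar>C\<bar> + 1) * (1 / (2 * \<bar>C\<bar> + 1))"
      using d by (intro mult_mono) auto
    also have "\<dots> = 1" by simp
    finally have "(L2w_norm I w (\<psi> lam))\<^sup>2 \<le>
        (8 * C\<^sup>2 * (cmod (lam - lam0))\<^sup>2 + 2) * (L2w_norm I w (\<psi> lam0))\<^sup>2"
      by (intro resolvent_bound_difference[where T = M and \<mu> = \<mu>, OF w_pos] C weyl lX lam0 diff)
    also have "\<dots> \<le> (8 * C\<^sup>2 * (2 * R1)\<^sup>2 + 2) * (L2w_norm I w (\<psi> lam0))\<^sup>2"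
    proof (intro mult_right_mono add_right_mono mult_left_mono power_mono)
      have "dist lam lam0 \<le> dist \<mu> lam + dist \<mu> lam0"
        by (metis dist_commute dist_triangle)
      also have "\<dots> \<le> 2 * R1"
        using lX lam0 by (auto simp: X_def)
      finally show "cmod (lam - lam0) \<le> 2 * R1"
        by (simp add: dist_norm)
    qed auto
    finally show ?thesis .
  qed

  \<comment> \<open>Boundedness of \<open>m\<close> in a punctured neighbourhood of \<mu>\<close>
  have "\<exists>B. \<forall>\<^sub>F lam in nhds \<mu>. lam \<in> Y \<longrightarrow> cmod (mf lam) \<le> B"
  proof (rule sl_fundamental.coefficient_bounded_if_norm_bounded[OF fund dI I_leb w_pos])
    show "(\<lambda>x. \<theta> lam x + mf lam * \<phi> lam x) \<in> L2w I w" if "lam \<in> Y" for lam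
      using weyl(1)[of lam] that YX unfolding \<psi>_def by blast
    show "(L2w_norm I w (\<lambda>x. \<theta> lam x + mf lam * \<phi> lam x))\<^sup>2 \<le>
        (8 * C\<^sup>2 * (2 * R1)\<^sup>2 + 2) * (L2w_norm I w (\<psi> lam0))\<^sup>2" if "lam \<in> Y" for lam
      using bound[OF that] unfolding \<psi>_def .
  qed
  then obtain B R0 where R0: "R0 > 0" "\<And>z. dist z \<mu> < R0 \<Longrightarrow> z \<in> Y \<Longrightarrow> cmod (mf z) \<le> B"
    unfolding eventually_nhds_metric by blast
  \<comment> \<open>Within this radius all three facts hold together: the bound for
    \<open>mf\<close>, membership in \<open>Y\<close> (hence in the disc of radius
    \<open>R1\<close>), and the convergence to \<open>l\<close>.\<close>
  define R where "R = min R0 (min \<rho> R2)"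
  have R: "R > 0" "R \<le> R0" "R \<le> \<rho>" "R \<le> R1" "R \<le> R2"
    using R0(1) \<rho> R2(1) by (auto simp: R_def)
  have mf_bound: "cmod (mf z) \<le> B" if "z \<in> ball \<mu> R - {\<mu>}" for z
    using that R by (intro R0(2)) (auto simp: Y_def dist_commute)

  \<comment> \<open>Convergence expressed by the quotients of \<open>N\<close> and
    \<open>D\<close>\<close>
  have nz: "\<forall>\<^sub>F n in sequentially. \<forall>z\<in>cball \<mu> s - ball \<mu> r. N n z \<noteq> 0 \<and> D n z \<noteq> 0"
    and lim_m: "uniform_limit (cball \<mu> s - ball \<mu> r) (\<lambda>n z. - N n z / D n z) mf sequentially"
    and lim_l: "uniform_limit (cball \<mu> s - ball \<mu> r) (\<lambda>n z. D n z / N n z) (\<lambda>z. THE v. l z v) sequentially"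
    if "0 < r" "r < s" "s < R" for r s
  proof -
    have s: "s < R1" "s < R2" using that R by auto
    have em: "\<forall>\<^sub>F n in sequentially. \<forall>z\<in>cball \<mu> s - ball \<mu> r. D n z \<noteq> 0 \<and> (THE v. m\<^sub>n n z v) = - N n z / D n z"
      using R1(3)[OF that(1,2) s(1)]
    proof eventually_elim
      case (elim n)
      show ?case
      proof
        fix z assume "z \<in> cball \<mu> s - ball \<mu> r"
        from bspec[OF elim this] have "\<exists>!v. N n z + v * D n z = 0" unfolding mn .
        from unique_root_linear[OF this]
        show "D n z \<noteq> 0 \<and> (THE v. m\<^sub>n n z v) = - N n z / D n z" unfolding mn by (rule conjI)
      qed
    qed
    have el: "\<forall>\<^sub>F n in sequentially. \<forall>z\<in>cball \<mu> s - ball \<mu> r. N n z \<noteq> 0 \<and> (THE v. l\<^sub>n n z v) = D n z / N n z"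
      using R2(3)[OF that(1,2) s(2)]
    proof eventually_elim
      case (elim n)
      show ?case
      proof
        fix z assume "z \<in> cball \<mu> s - ball \<mu> r"
        from bspec[OF elim this] have "\<exists>!v. D n z + v * (- N n z) = 0" unfolding ln .
        from unique_root_linear[OF this]
        show "N n z \<noteq> 0 \<and> (THE v. l\<^sub>n n z v) = D n z / N n z" unfolding ln by simp
      qed
    qed
    show "\<forall>\<^sub>F n in sequentially. \<forall>z\<in>cball \<mu> s - ball \<mu> r. N n z \<noteq> 0 \<and> D n z \<noteq> 0"
      using em el by eventually_elim simp
    show "uniform_limit (cball \<mu> s - ball \<mu> r) (\<lambda>n z. - N n z / D n z) mf sequentially"
      using R1(4)[OF that(1,2) s(1)] unfolding mf_def
      by (rule uniform_limit_cong[THEN iffD1, rotated -1]) (use em in \<open>auto elim: eventually_mono\<close>)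
    show "uniform_limit (cball \<mu> s - ball \<mu> r) (\<lambda>n z. D n z / N n z) (\<lambda>z. THE v. l z v) sequentially"
      using R2(4)[OF that(1,2) s(2)]
      by (rule uniform_limit_cong[THEN iffD1, rotated -1]) (use el in \<open>auto elim: eventually_mono\<close>)
  qed

  \<comment> \<open>Failure of the first alternative yields the two eigenvalue sequences\<close>
  show ?thesis
  proof (rule disj_imp[THEN iffD2], rule impI)
    assume not_a: "\<not> (\<exists>U N. open U \<and> \<mu> \<in> U \<and> (\<forall>n\<ge>N. \<forall>lam\<in>U. \<not> op_eigenvalue (I\<^sub>n n) (M\<^sub>n n) lam))"
    have ev: "\<exists>n\<ge>n0. \<exists>lam\<in>ball \<mu> \<delta>. op_eigenvalue (I\<^sub>n n) (M\<^sub>n n) lam" if "\<delta> > 0" for n0 \<delta>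
    proof (rule ccontr)
      assume "\<not> ?thesis"
      then have "open (ball \<mu> \<delta>) \<and> \<mu> \<in> ball \<mu> \<delta> \<and>
          (\<forall>n\<ge>n0. \<forall>lam\<in>ball \<mu> \<delta>. \<not> op_eigenvalue (I\<^sub>n n) (M\<^sub>n n) lam)"
        using that by auto
      then show False using not_a by blast
    qed
    have both: "\<exists>n lam nu. n0 \<le> n \<and> op_eigenvalue (I\<^sub>n n) (M\<^sub>n n) lam \<and> op_eigenvalue (I\<^sub>n n) (L\<^sub>n n) nu \<and>
        dist lam \<mu> < \<epsilon> \<and> dist nu \<mu> < \<epsilon>" if eps: "\<epsilon> > 0" for n0 \<epsilon>
    proof -
      have "\<exists>\<delta>>0. \<forall>\<^sub>F n in sequentially.
          (\<exists>z\<in>ball \<mu> \<delta>. D n z = 0) \<longrightarrow> (\<exists>z\<in>ball \<mu> \<epsilon>. N n z = 0)"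
        by (rule zeros_accompany_poles[OF N_hol D_hol R(1) nz lim_m lim_l mf_bound eps])
      then obtain \<delta> n1 where \<delta>: "\<delta> > 0" and n1: "\<forall>n\<ge>n1.
          (\<exists>z\<in>ball \<mu> \<delta>. D n z = 0) \<longrightarrow> (\<exists>z\<in>ball \<mu> \<epsilon>. N n z = 0)"
        unfolding eventually_sequentially by (elim exE conjE) (rule that)
      \<comment> \<open>The radius \<open>min \<delta> \<epsilon>\<close> serves twice: \<delta>
        triggers a nearby zero of \<open>N n\<close>, and \<epsilon> is the required closeness of
        \<open>lam\<close> itself.\<close>
      obtain n lam where n: "n \<ge> max n0 n1" and lam: "lam \<in> ball \<mu> (min \<delta> \<epsilon>)"
        and eig: "op_eigenvalue (I\<^sub>n n) (M\<^sub>n n) lam"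
        using ev[of "min \<delta> \<epsilon>" "max n0 n1"] \<delta> eps by auto
      have "D n lam = 0"
        using sl_fundamental.eigenvalue_characteristic[OF fund] eig
        unfolding D_def I\<^sub>n_def M\<^sub>n_def by blast
      then obtain nu where nu: "nu \<in> ball \<mu> \<epsilon>" "N n nu = 0"
        using n1[THEN spec[of _ n]] n lam by auto
      have "op_eigenvalue (I\<^sub>n n) (L\<^sub>n n) nu"
        using sl_fundamental.characteristic_eigenvalue[OF fund] nu(2)
        unfolding N_def I\<^sub>n_def L\<^sub>n_def by blast
      then have "n0 \<le> n \<and> op_eigenvalue (I\<^sub>n n) (M\<^sub>n n) lam \<and> op_eigenvalue (I\<^sub>n n) (L\<^sub>n n) nu \<and>
          dist lam \<mu> < \<epsilon> \<and> dist nu \<mu> < \<epsilon>"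
        using n lam eig nu(1) by (simp add: dist_commute)
      then show ?thesis by blast
    qed
    \<comment> \<open>Index and both eigenvalues are chosen together as one triple, with tolerance
      \<open>1 / (j + 1)\<close>; dependent choice then makes the indices strictly increasing, and
      \<open>0 < n\<close> is the positivity of the indices claimed in the conclusion.\<close>
    define Q where "Q = (\<lambda>j (n, lam, nu). 0 < n \<and> op_eigenvalue (I\<^sub>n n) (M\<^sub>n n) lam \<and>
        op_eigenvalue (I\<^sub>n n) (L\<^sub>n n) nu \<and> dist lam \<mu> < 1 / real (Suc j) \<and> dist nu \<mu> < 1 / real (Suc j))"
    have Q: "\<exists>x. Q j x \<and> n0 < fst x" for j n0
    proof -
      obtain n lam nu where "Suc n0 \<le> n" "op_eigenvalue (I\<^sub>n n) (M\<^sub>n n) lam" "op_eigenvalue (I\<^sub>n n) (L\<^sub>n n) nu"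
        "dist lam \<mu> < 1 / real (Suc j)" "dist nu \<mu> < 1 / real (Suc j)"
        using both[of "1 / real (Suc j)" "Suc n0"] by auto
      then have "Q j (n, lam, nu) \<and> n0 < fst (n, lam, nu)" by (simp add: Q_def)
      then show ?thesis by blast
    qed
    have "\<exists>f. \<forall>j. Q j (f j) \<and> fst (f j) < fst (f (Suc j))"
    proof (rule dependent_nat_choice)
      show "\<exists>x. Q 0 x" using Q by blast
      show "\<exists>y. Q (Suc j) y \<and> fst x < fst y" for x j using Q by blast
    qed
    then obtain f where f: "\<And>j. Q j (f j)" "\<And>j. fst (f j) < fst (f (Suc j))" by blast
    define k where "k = (\<lambda>j. fst (f j))"
    define lams where "lams = (\<lambda>j. fst (snd (f j)))"
    define \<mu>s where "\<mu>s = (\<lambda>j. snd (snd (f j)))"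
    have fk: "0 < k j" "op_eigenvalue (I\<^sub>n (k j)) (M\<^sub>n (k j)) (lams j)" "op_eigenvalue (I\<^sub>n (k j)) (L\<^sub>n (k j)) (\<mu>s j)"
      "dist (lams j) \<mu> < 1 / real (Suc j)" "dist (\<mu>s j) \<mu> < 1 / real (Suc j)" for j
      using f(1)[of j] by (simp_all add: Q_def k_def lams_def \<mu>s_def split_beta)
    have zero: "(\<lambda>j. 1 / real (Suc j)) \<longlonglongrightarrow> 0"
      by (rule lim_1_over_n[THEN LIMSEQ_Suc])
    have "strict_mono k"
      unfolding k_def by (rule strict_mono_Suc_iff[THEN iffD2]) (use f(2) in blast)
    moreover have "lams \<longlonglongrightarrow> \<mu>" "\<mu>s \<longlonglongrightarrow> \<mu>"
      unfolding tendsto_dist_iff[of _ \<mu>]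
      by (rule Lim_null_comparison[OF _ zero], rule always_eventually, use fk(4,5) in \<open>simp add: less_imp_le\<close>)+
    ultimately show "\<exists>(k :: nat \<Rightarrow> nat) (lams :: nat \<Rightarrow> complex) (\<mu>s :: nat \<Rightarrow> complex).
        strict_mono k \<and> (\<forall>j. 0 < k j) \<and>
        (\<forall>j. lams j \<in> op_spectrum (I\<^sub>n (k j)) w (M\<^sub>n (k j))) \<and>
        (\<forall>j. \<mu>s j \<in> op_spectrum (I\<^sub>n (k j)) w (L\<^sub>n (k j))) \<and>
        lams \<longlonglongrightarrow> \<mu> \<and> \<mu>s \<longlonglongrightarrow> \<mu>"
      using fk(1-3) op_eigenvalue_in_spectrum by blast
  qed
qed

end
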